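(* Let $n\ge2$, $m\ge1$, $\beta>0$, and let $\mathcal Q=n+m(\beta+1)$. On $\mathbb R^{n+m}$, with points $\xi=(x,y)$, $x\in\mathbb R^n$, $y\in\mathbb R^m$, let $\nabla_L=(\nabla_x,|x|^\beta\nabla_y)$. Then for every $1\le p<\mathcal Q$ there is a constant $C$ such that $$\left(\int_{\mathbb R^{n+m}}|f(\xi)|^{\frac{\mathcal Qp}{\mathcal Q-p}}\,d\xi\right)^{\frac{\mathcal Q-p}{\mathcal Q}}\le C\int_{\mathbb R^{n+m}}|\nabla_Lf(\xi)|^p\,d\xi$$ for all $f\in C_c^\infty(\mathbb R^{n+m})$.
   Context: $d\xi$ is Lebesgue measure and $|\nabla_Lf|^2=\sum_{i=1}^n|\partial_{x_i}f|^2+|x|^{2\beta}\sum_{j=1}^m|\partial_{y_j}f|^2$. $\nabla_L$ is the gradient associated with the Grushin operator $L=-\sum_{i=1}^n\partial_{x_i}^2-|x|^{2\beta}\sum_{j=1}^m\partial_{y_j}^2$, and $\mathcal Q$ is its homogeneous dimension. *)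

theory Defs
  imports "HOL-Analysis.Analysis"
begin

definition partial_deriv ::
  "'a::real_normed_vector \<Rightarrow> ('a \<Rightarrow> 'b::real_normed_vector) \<Rightarrow> 'a \<Rightarrow> 'b"
  where "partial_deriv b f \<xi> = vector_derivative (\<lambda>t. f (\<xi> + t *\<^sub>R b)) (at 0)"

primrec C_k :: "nat \<Rightarrow> ('a::euclidean_space \<Rightarrow> 'b::real_normed_vector) \<Rightarrow> bool"
  where
    "C_k 0 f \<longleftrightarrow> continuous_on UNIV f"
  | "C_k (Suc k) f \<longleftrightarrow>
      (\<forall>\<xi>. f differentiable (at \<xi>)) \<and> (\<forall>b\<in>Basis. C_k k (partial_deriv b f))"

definition C_c_infinity :: "('a::euclidean_space \<Rightarrow> 'b::real_normed_vector) set"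
  where "C_c_infinity = {f. (\<forall>k. C_k k f) \<and> compact (closure {\<xi>. f \<xi> \<noteq> 0})}"

definition grushin_grad ::
  "real \<Rightarrow> ((real ^ 'n) \<times> (real ^ 'm) \<Rightarrow> 'b::real_normed_vector)
    \<Rightarrow> (real ^ 'n) \<times> (real ^ 'm) \<Rightarrow> ('b ^ 'n) \<times> ('b ^ 'm)"
  where "grushin_grad \<beta> f \<xi> =
    (\<chi> i. partial_deriv (axis i 1, 0) f \<xi>,
     \<chi> j. (norm (fst \<xi>) powr \<beta>) *\<^sub>R partial_deriv (0, axis j 1) f \<xi>)"

text \<open>The norm on the codomain is the Euclidean one, so it is the usual length of the
  Grushin gradient:\<close>

lemma norm_grushin_grad_square:
  "(norm (grushin_grad \<beta> f (x, y)))\<^sup>2 =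
    (\<Sum>i\<in>UNIV. (norm (partial_deriv (axis i 1, 0) f (x, y)))\<^sup>2) +
    norm x powr (2 * \<beta>) * (\<Sum>j\<in>UNIV. (norm (partial_deriv (0, axis j 1) f (x, y)))\<^sup>2)"
proof -
  have "norm x powr (2 * \<beta>) = (norm x powr \<beta>)\<^sup>2"
    by (simp add: power2_eq_square flip: powr_add)
  then show ?thesis
    by (simp add: grushin_grad_def norm_Pair norm_vec_def L2_set_def sum_nonneg
        power_mult_distrib sum_distrib_left)
qed

end

theory Submission
  imports Defs
begin

text \<open>Write \<open>\<xi> = (x, y)\<close>, with \<open>x\<close> of dimension \<open>n\<close> and \<open>y\<close> of dimension \<open>m\<close>, and \<open>N = n + m\<close>. The case
\<open>p = 1\<close> carries the whole argument. Bounding \<open>\<bar>f\<bar>\<close> at a point by the integral of the derivative over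
each of the \<open>N\<close> coordinate lines through it, as Gagliardo and Nirenberg do, gives in the \<open>x\<close>-directions
a bound for \<open>\<bar>f\<bar>\<close> by line integrals of the Grushin gradient. In the \<open>y\<close>-directions it gives one for
\<open>\<bar>x\<bar> powr \<beta> * \<bar>f\<bar>\<close>, since the degenerate factor is constant along these lines. The Loomis-Whitney
inequality then controls \<open>\<bar>f\<bar> powr (N / (N - 1))\<close> with the weight
\<open>\<bar>x\<bar> powr (m * \<beta> / (N - 1))\<close>, which is too weak near \<open>x = 0\<close>. The loss is made up by Hardy's
inequality, which for \<open>n \<ge> 2\<close> controls \<open>\<bar>f\<bar> / \<bar>x\<bar>\<close>. Hoelder's inequality interpolates between the
two so that the weights cancel, and the exponent that results is exactly \<open>Q / (Q - 1)\<close>.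

Both ingredients follow from the line bounds alone. For Loomis-Whitney this is
\<open>Gagliardo_inequality\<close>, which rests on \<open>Finner_inequality\<close>; for Hardy it is
\<open>Hardy_inequality_L1\<close>, where \<open>1 / \<bar>x\<bar>\<close> is dominated by a sum of weights, one per direction, whose
integrals over all lines in that direction are bounded. They are combined in \<open>Grushin_Sobolev_L1\<close>.

For \<open>p > 1\<close> the case \<open>p = 1\<close> is applied to \<open>\<bar>f\<bar> powr \<gamma>\<close> with \<open>\<gamma> = p * (Q - 1) / (Q - p)\<close>. Hoelder's
inequality splits the integral of \<open>\<bar>f\<bar> powr (\<gamma> - 1)\<close> times the gradient, and the power of \<open>\<bar>f\<bar>\<close> that
appears is again the critical one; since \<open>p < Q\<close> its integral occurs with a smaller exponent than on
the left and can be divided out (\<open>absorb_powr_bound\<close>).\<close>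

section \<open>Real powers of extended nonnegative numbers\<close>

text \<open>Infinity is sent to infinity and 0 to 0 for every exponent, so that multiplicativity holds
without side conditions.\<close>

definition epowr :: "ennreal \<Rightarrow> real \<Rightarrow> ennreal"
  where "epowr x a = (if x = top then top else ennreal (enn2real x powr a))"

lemma epowr_top [simp]: "epowr top a = top"
  by (simp add: epowr_def)

lemma epowr_0 [simp]: "epowr 0 a = 0"
  by (simp add: epowr_def)

lemma epowr_ennreal: "0 \<le> x \<Longrightarrow> epowr (ennreal x) a = ennreal (x powr a)"
  by (simp add: epowr_def)

lemma epowr_1 [simp]: "epowr 1 a = 1"
  using epowr_ennreal[of 1 a] by simp

lemma epowr_eq_0_iff [simp]: "epowr x a = 0 \<longleftrightarrow> x = 0"
  by (cases x) (auto simp: epowr_ennreal)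

lemma epowr_mono: "x \<le> y \<Longrightarrow> 0 \<le> a \<Longrightarrow> epowr x a \<le> epowr y a"
  by (cases x; cases y) (auto simp: epowr_ennreal powr_mono2 top_unique)

lemma epowr_mult: "epowr (x * y) a = epowr x a * epowr y a"
proof -
  have top: "epowr (top * y) a = epowr top a * epowr y a" for y
    by (cases "y = 0") (simp_all add: ennreal_top_mult)
  show ?thesis
  proof (cases "x = top \<or> y = top")
    case True
    then show ?thesis
      using top by (metis mult.commute)
  next
    case False
    then show ?thesis
      by (cases x; cases y)
        (auto simp: epowr_ennreal powr_mult simp flip: ennreal_mult)
  qed
qed

lemma epowr_prod: "epowr (\<Prod>i\<in>A. x i) a = (\<Prod>i\<in>A. epowr (x i) a)"
  by (induction A rule: infinite_finite_induct) (simp_all add: epowr_mult)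

lemma epowr_epowr: "epowr (epowr x a) b = epowr x (a * b)"
  by (cases x) (simp_all add: epowr_ennreal powr_powr)

lemma epowr_add: "epowr x (a + b) = epowr x a * epowr x b"
  by (cases x) (simp_all add: epowr_ennreal powr_add ennreal_mult)

lemma epowr_of_nat: "k \<noteq> 0 \<Longrightarrow> epowr x (real k) = x ^ k"
  by (cases x) (auto simp: epowr_ennreal ennreal_power powr_realpow' top_power_ennreal)

lemma borel_measurable_epowr [measurable (raw)]:
  assumes "f \<in> borel_measurable M"
  shows "(\<lambda>x. epowr (f x) a) \<in> borel_measurable M"
  using assms unfolding epowr_def by measurable

section \<open>Hoelder's and Finner's inequalities\<close>

lemma weighted_am_gm_real:
  fixes x c :: "'a \<Rightarrow> real"
  assumes "finite E" "\<And>e. e \<in> E \<Longrightarrow> 0 < c e" "(\<Sum>e\<in>E. c e) = 1" "\<And>e. e \<in> E \<Longrightarrow> 0 \<le> x e"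
  shows "(\<Prod>e\<in>E. x e powr c e) \<le> (\<Sum>e\<in>E. c e * x e)"
proof (cases "\<exists>e\<in>E. x e = 0")
  case True
  then have "(\<Prod>e\<in>E. x e powr c e) = 0"
    using assms(1) by simp
  also have "0 \<le> (\<Sum>e\<in>E. c e * x e)"
    using assms by (intro sum_nonneg mult_nonneg_nonneg) (auto simp: less_imp_le)
  finally show ?thesis .
next
  case False
  then have pos: "0 < x e" if "e \<in> E" for e
    using assms(4) that by fastforce
  have ne: "E \<noteq> {}"
    using assms(3) by auto
  have "(\<Sum>e\<in>E. c e * ln (x e)) \<le> ln (\<Sum>e\<in>E. c e *\<^sub>R x e)"
    by (rule concave_on_sum[OF assms(1) ne ln_concave assms(3)])
      (use assms(2) pos in \<open>auto simp: less_imp_le\<close>)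
  moreover have "0 < (\<Sum>e\<in>E. c e * x e)"
    using assms(1,2) ne pos by (intro sum_pos) auto
  ultimately have "exp (\<Sum>e\<in>E. c e * ln (x e)) \<le> (\<Sum>e\<in>E. c e * x e)"
    by (simp add: ln_ge_iff)
  moreover have "(\<Prod>e\<in>E. x e powr c e) = exp (\<Sum>e\<in>E. c e * ln (x e))"
    unfolding exp_sum[OF assms(1)] using False by (intro prod.cong) (auto simp: powr_def)
  ultimately show ?thesis
    by simp
qed

lemma weighted_am_gm:
  assumes "finite E" "\<And>e. e \<in> E \<Longrightarrow> 0 < c e" "(\<Sum>e\<in>E. c e) = 1"
  shows "(\<Prod>e\<in>E. epowr (x e) (c e)) \<le> (\<Sum>e\<in>E. ennreal (c e) * x e)"
proof (cases "\<exists>e\<in>E. x e = top")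
  case True
  then obtain e where e: "e \<in> E" "x e = top"
    by blast
  then have "ennreal (c e) * x e = top"
    using assms(2)[of e] by (auto simp: ennreal_mult_top ennreal_eq_0_iff)
  then have "(\<Sum>e\<in>E. ennreal (c e) * x e) = top"
    using e(1) assms(1) by auto
  then show ?thesis
    by simp
next
  case False
  define r where "r e = enn2real (x e)" for e
  have x: "x e = ennreal (r e)" if "e \<in> E" for e
    using False that by (simp add: r_def less_top)
  have r: "0 \<le> r e" for e
    by (simp add: r_def)
  have "(\<Prod>e\<in>E. epowr (x e) (c e)) = ennreal (\<Prod>e\<in>E. r e powr c e)"
    by (subst prod_ennreal[symmetric]) (auto simp: x epowr_ennreal r intro!: prod.cong)
  also have "\<dots> \<le> ennreal (\<Sum>e\<in>E. c e * r e)"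
    by (intro ennreal_leI weighted_am_gm_real assms) (auto simp: r)
  also have "\<dots> = (\<Sum>e\<in>E. ennreal (c e) * x e)"
    by (subst sum_ennreal[symmetric])
      (use assms(2) in \<open>auto simp: x ennreal_mult r less_imp_le intro!: sum.cong\<close>)
  finally show ?thesis .
qed

text \<open>After dividing each function by its integral, the weighted arithmetic-geometric mean inequality
holds pointwise and integrates to 1. If one integral vanishes, the integrand vanishes almost
everywhere; if one is infinite and none vanishes, the right-hand side is infinite.\<close>

lemma nn_integral_Holder:
  fixes E :: "'e set" and g :: "'e \<Rightarrow> 'a \<Rightarrow> ennreal"
  assumes fin: "finite E" and c: "\<And>e. e \<in> E \<Longrightarrow> 0 < c e" "(\<Sum>e\<in>E. c e) = 1"
    and g [measurable]: "\<And>e. e \<in> E \<Longrightarrow> g e \<in> borel_measurable M"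
  shows "(\<integral>\<^sup>+x. (\<Prod>e\<in>E. epowr (g e x) (c e)) \<partial>M) \<le> (\<Prod>e\<in>E. epowr (\<integral>\<^sup>+x. g e x \<partial>M) (c e))"
proof -
  define A where "A e = (\<integral>\<^sup>+x. g e x \<partial>M)" for e
  consider e where "e \<in> E" "A e = 0" | e where "\<forall>e\<in>E. A e \<noteq> 0" "e \<in> E" "A e = top"
    | "\<forall>e\<in>E. A e \<noteq> 0 \<and> A e \<noteq> top"
    by blast
  then show ?thesis
  proof cases
    case 1
    have "AE x in M. g e x = 0"
      using 1 by (simp add: A_def nn_integral_0_iff_AE)
    then have "AE x in M. (\<Prod>e\<in>E. epowr (g e x) (c e)) = 0"
      by eventually_elim (use 1(1) fin in auto)
    then have "(\<integral>\<^sup>+x. (\<Prod>e\<in>E. epowr (g e x) (c e)) \<partial>M) = 0"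
      by (subst nn_integral_0_iff_AE) auto
    then show ?thesis
      by simp
  next
    case 2
    then have "(\<Prod>e\<in>E. epowr (A e) (c e)) = top"
      using fin by (force simp: ennreal_prod_eq_top)
    then show ?thesis
      by (simp add: A_def)
  next
    case 3
    define P where "P = (\<Prod>e\<in>E. epowr (A e) (c e))"
    have gA: "g e x = A e * (g e x / A e)" if "e \<in> E" for e x
    using 3 that by (simp add: ennreal_times_divide ennreal_mult_divide_eq mult.commute[of "A e"])
  have split: "epowr (g e x) (c e) = epowr (A e) (c e) * epowr (g e x / A e) (c e)"
      if "e \<in> E" for e x
      using gA[OF that] by (metis epowr_mult)
    have "(\<Prod>e\<in>E. epowr (g e x) (c e)) = P * (\<Prod>e\<in>E. epowr (g e x / A e) (c e))" for x
      by (simp add: P_def split prod.distrib cong: prod.cong)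
    then have "(\<integral>\<^sup>+x. (\<Prod>e\<in>E. epowr (g e x) (c e)) \<partial>M)
        \<le> (\<integral>\<^sup>+x. P * (\<Sum>e\<in>E. ennreal (c e) * (g e x / A e)) \<partial>M)"
      by (auto intro!: nn_integral_mono mult_left_mono weighted_am_gm fin c)
    also have "\<dots> = P * (\<Sum>e\<in>E. ennreal (c e) * (A e / A e))"
      by (simp add: nn_integral_cmult nn_integral_sum nn_integral_divide A_def)
    also have "(\<Sum>e\<in>E. ennreal (c e) * (A e / A e)) = (\<Sum>e\<in>E. ennreal (c e))"
      using 3 by (intro sum.cong) (auto simp: less_top ennreal_divide_self)
    also have "\<dots> = 1"
      using c by (subst sum_ennreal) (auto simp: less_imp_le)
    finally show ?thesis
      by (simp add: P_def A_def)
  qed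
qed

corollary nn_integral_Holder_pair:
  assumes [measurable]: "f \<in> borel_measurable M" "g \<in> borel_measurable M"
    and ab: "0 < a" "0 < b" "a + b = 1"
  shows "(\<integral>\<^sup>+x. epowr (f x) a * epowr (g x) b \<partial>M)
    \<le> epowr (\<integral>\<^sup>+x. f x \<partial>M) a * epowr (\<integral>\<^sup>+x. g x \<partial>M) b"
  using nn_integral_Holder[of UNIV "\<lambda>i. if i then a else b" "\<lambda>i. if i then f else g" M] ab
  by (simp add: UNIV_bool mult.commute add.commute)

text \<open>Every coordinate is covered by sets \<open>S e\<close> of total weight 1. Integrating out one coordinate
\<open>i\<close>, the factors with \<open>i \<notin> S e\<close> are constants and Hoelder's inequality applies to the others, whose
weights sum to 1; this replaces \<open>g e\<close> by its integral over the coordinate \<open>i\<close> and \<open>S e\<close> by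
\<open>S e - {i}\<close>, and the covering condition survives for the remaining coordinates. The Loomis-Whitney
inequality is the case where the sets are the complements of single coordinates.\<close>

lemma (in product_sigma_finite) Finner_inequality:
  fixes E :: "'e set" and S :: "'e \<Rightarrow> 'i set"
  assumes "finite I" and fin: "finite E" and c: "\<And>e. e \<in> E \<Longrightarrow> 0 < c e"
    and "\<And>e. e \<in> E \<Longrightarrow> S e \<subseteq> I"
    and "\<And>i. i \<in> I \<Longrightarrow> (\<Sum>e | e \<in> E \<and> i \<in> S e. c e) = 1"
    and "\<And>e. e \<in> E \<Longrightarrow> g e \<in> borel_measurable (PiM (S e) M)"
  shows "(\<integral>\<^sup>+x. (\<Prod>e\<in>E. epowr (g e (restrict x (S e))) (c e)) \<partial>PiM I M)
    \<le> (\<Prod>e\<in>E. epowr (\<integral>\<^sup>+x. g e x \<partial>PiM (S e) M) (c e))"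
  using \<open>finite I\<close> assms(4-)
proof (induction I arbitrary: S g rule: finite_induct)
  case empty
  then have S: "S e = {}" if "e \<in> E" for e
    using that by blast
  show ?case
    by (simp add: PiM_empty nn_integral_count_space_finite S restrict_def cong: prod.cong)
next
  case (insert i I)
  note insert.prems(3) [measurable]
  define S' where "S' e = S e - {i}" for e
  define g' where "g' e x = (if i \<in> S e then \<integral>\<^sup>+t. g e (x(i := t)) \<partial>M i else g e x)" for e x
  have Si: "insert i (S' e) = S e" if "i \<in> S e" for e
    using that by (auto simp: S'_def)
  have finS: "finite (S' e)" if "e \<in> E" for e
    using insert.prems(1)[OF that] insert.hyps(1) finite_subset by (fastforce simp: S'_def)
  have S'_eq: "S' e = S e" if "i \<notin> S e" for e
    using that by (auto simp: S'_def)
  have upd: "(\<lambda>x. g e (x(i := t))) \<in> borel_measurable (PiM (S' e) M)"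
    if "e \<in> E" "i \<in> S e" "t \<in> space (M i)" for e t
    using insert.prems(3)[OF that(1)] that(3)
    unfolding Si[OF that(2), symmetric] by measurable
  have g'[measurable]: "g' e \<in> borel_measurable (PiM (S' e) M)" if "e \<in> E" for e
  proof (cases "i \<in> S e")
    case True
    have [measurable]: "g e \<in> borel_measurable (PiM (insert i (S' e)) M)"
      using insert.prems(3)[OF that] Si[OF True] by simp
    show ?thesis
      using True by (simp add: g'_def[abs_def])
  next
    case False
    then show ?thesis
      using insert.prems(3)[OF that] by (simp add: g'_def[abs_def] S'_eq)
  qed
  have restr_in: "restrict (x(i := t)) (S e) = (restrict x (S' e))(i := t)" if "i \<in> S e" for e x t
    using that by (auto simp: fun_eq_iff S'_def)
  have restr_out: "restrict (x(i := t)) (S e) = restrict x (S' e)" if "i \<notin> S e" for e x t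
    using that by (auto simp: fun_eq_iff S'_def)
  have slice: "(\<integral>\<^sup>+t. (\<Prod>e\<in>E. epowr (g e (restrict (x(i := t)) (S e))) (c e)) \<partial>M i)
      \<le> (\<Prod>e\<in>E. epowr (g' e (restrict x (S' e))) (c e))" (is "?L \<le> ?R")
    if x: "x \<in> space (PiM I M)" for x
  proof -
    let ?E = "{e \<in> E. i \<in> S e}" and ?F = "{e \<in> E. i \<notin> S e}"
    have m [measurable]: "(\<lambda>t. g e ((restrict x (S' e))(i := t))) \<in> borel_measurable (M i)"
      if "e \<in> ?E" for e
    proof -
      have ge [measurable]: "g e \<in> borel_measurable (PiM (insert i (S' e)) M)"
        using insert.prems(3) Si that by simp
      have [measurable]: "restrict x (S' e) \<in> space (PiM (S' e) M)"
        using x insert.prems(1)[of e] that by (fastforce simp: space_PiM S'_def)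
      show ?thesis
        by measurable
    qed
    have E: "E = ?E \<union> ?F"
      by auto
    have sp: "(\<Prod>e\<in>E. h e) = (\<Prod>e\<in>?F. h e) * (\<Prod>e\<in>?E. h e)" for h :: "'e \<Rightarrow> ennreal"
      using fin by (subst E, subst prod.union_disjoint) (auto simp: mult.commute)
    have "?L = (\<integral>\<^sup>+t. (\<Prod>e\<in>?F. epowr (g e (restrict x (S' e))) (c e)) *
        (\<Prod>e\<in>?E. epowr (g e ((restrict x (S' e))(i := t))) (c e)) \<partial>M i)"
      unfolding sp
      by (intro nn_integral_cong arg_cong2[where f = "(*)"] prod.cong refl)
        (simp_all only: restr_in restr_out mem_Collect_eq simp_thms)
    also have "\<dots> = (\<Prod>e\<in>?F. epowr (g e (restrict x (S' e))) (c e)) *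
        (\<integral>\<^sup>+t. (\<Prod>e\<in>?E. epowr (g e ((restrict x (S' e))(i := t))) (c e)) \<partial>M i)"
      by (intro nn_integral_cmult borel_measurable_prod_ennreal) measurable
    also have "\<dots> \<le> (\<Prod>e\<in>?F. epowr (g e (restrict x (S' e))) (c e)) *
        (\<Prod>e\<in>?E. epowr (\<integral>\<^sup>+t. g e ((restrict x (S' e))(i := t)) \<partial>M i) (c e))"
      using fin c insert.prems(2)[of i] by (intro mult_left_mono nn_integral_Holder m) auto
    also have "\<dots> = ?R"
      unfolding sp by (intro arg_cong2[where f = "(*)"] prod.cong refl) (simp_all add: g'_def)
    finally show ?thesis .
  qed
  have [measurable]: "(\<lambda>x. \<Prod>e\<in>E. epowr (g e (restrict x (S e))) (c e))
      \<in> borel_measurable (PiM (insert i I) M)"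
  proof (intro borel_measurable_prod_ennreal borel_measurable_epowr)
    fix e assume e: "e \<in> E"
    show "(\<lambda>x. g e (restrict x (S e))) \<in> borel_measurable (PiM (insert i I) M)"
      using measurable_restrict_subset[OF insert.prems(1)[OF e]] insert.prems(3)[OF e]
      by (rule measurable_compose)
  qed
  have "(\<integral>\<^sup>+x. (\<Prod>e\<in>E. epowr (g e (restrict x (S e))) (c e)) \<partial>PiM (insert i I) M)
      = (\<integral>\<^sup>+x. \<integral>\<^sup>+t. (\<Prod>e\<in>E. epowr (g e (restrict (x(i := t)) (S e))) (c e)) \<partial>M i \<partial>PiM I M)"
    by (intro product_nn_integral_insert insert.hyps) measurable
  also have "\<dots> \<le> (\<integral>\<^sup>+x. (\<Prod>e\<in>E. epowr (g' e (restrict x (S' e))) (c e)) \<partial>PiM I M)"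
    by (intro nn_integral_mono slice)
  also have "\<dots> \<le> (\<Prod>e\<in>E. epowr (\<integral>\<^sup>+x. g' e x \<partial>PiM (S' e) M) (c e))"
  proof (intro insert.IH g')
    show "S' e \<subseteq> I" if "e \<in> E" for e
      using insert.prems(1)[OF that] by (auto simp: S'_def)
    show "(\<Sum>e | e \<in> E \<and> j \<in> S' e. c e) = 1" if "j \<in> I" for j
    proof -
      have "{e \<in> E. j \<in> S' e} = {e \<in> E. j \<in> S e}"
        using that insert.hyps(2) by (auto simp: S'_def)
      then show ?thesis
        using insert.prems(2)[of j] that by simp
    qed
  qed
  also have "\<dots> = (\<Prod>e\<in>E. epowr (\<integral>\<^sup>+x. g e x \<partial>PiM (S e) M) (c e))"
  proof (intro prod.cong refl arg_cong2[where f = epowr])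
    fix e assume e: "e \<in> E"
    show "(\<integral>\<^sup>+x. g' e x \<partial>PiM (S' e) M) = (\<integral>\<^sup>+x. g e x \<partial>PiM (S e) M)"
    proof (cases "i \<in> S e")
      case True
      have "(\<integral>\<^sup>+x. g e x \<partial>PiM (insert i (S' e)) M) = (\<integral>\<^sup>+x. \<integral>\<^sup>+t. g e (x(i := t)) \<partial>M i \<partial>PiM (S' e) M)"
        using insert.prems(3)[OF e] Si[OF True] finS[OF e]
        by (intro product_nn_integral_insert) (auto simp: S'_def)
      then show ?thesis
        using True Si[OF True] by (simp add: g'_def)
    next
      case False
      then show ?thesis
        by (simp add: g'_def S'_eq)
    qed
  qed
  finally show ?case .
qed

section \<open>Bounds along coordinate lines\<close>

lemma nn_integral_lborel_slice:
  fixes f :: "'a::euclidean_space \<Rightarrow> ennreal"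
  assumes b: "b \<in> Basis" and [measurable]: "f \<in> borel_measurable borel"
  shows "(\<integral>\<^sup>+\<xi>. f \<xi> \<partial>lborel) =
    (\<integral>\<^sup>+z. \<integral>\<^sup>+t. f ((\<Sum>i\<in>Basis - {b}. z i *\<^sub>R i) + t *\<^sub>R b) \<partial>lborel \<partial>(\<Pi>\<^sub>M i\<in>Basis - {b}. lborel))"
proof -
  interpret product_sigma_finite "\<lambda>i::'a. lborel :: real measure" ..
  have B: "insert b (Basis - {b}) = Basis"
    using b by auto
  have "(\<integral>\<^sup>+\<xi>. f \<xi> \<partial>lborel) = (\<integral>\<^sup>+z. f (\<Sum>i\<in>Basis. z i *\<^sub>R i) \<partial>(\<Pi>\<^sub>M i\<in>insert b (Basis - {b}). lborel))"
    unfolding B by (subst lborel_eq, subst nn_integral_distr) (auto intro!: borel_measurable_sum)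
  also have "\<dots> = (\<integral>\<^sup>+z. \<integral>\<^sup>+t. f (\<Sum>i\<in>Basis. (z(b := t)) i *\<^sub>R i) \<partial>lborel \<partial>(\<Pi>\<^sub>M i\<in>Basis - {b}. lborel))"
    by (subst product_nn_integral_insert) (auto simp: B)
  finally have "(\<integral>\<^sup>+\<xi>. f \<xi> \<partial>lborel) =
    (\<integral>\<^sup>+z. \<integral>\<^sup>+t. f (\<Sum>i\<in>Basis. (z(b := t)) i *\<^sub>R i) \<partial>lborel \<partial>(\<Pi>\<^sub>M i\<in>Basis - {b}. lborel))" .
  moreover have "(\<Sum>i\<in>Basis. (z(b := t)) i *\<^sub>R i) = (\<Sum>i\<in>Basis - {b}. z i *\<^sub>R i) + t *\<^sub>R b" for z t
    using b by (subst sum.remove[of _ b]) (auto simp: add.commute intro!: sum.cong)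
  ultimately show ?thesis
    by (simp only:)
qed

lemma nn_integral_line_translate:
  fixes f :: "'a::euclidean_space \<Rightarrow> ennreal"
  assumes [measurable]: "f \<in> borel_measurable borel"
  shows "(\<integral>\<^sup>+t. f (\<xi> + s *\<^sub>R b + t *\<^sub>R b) \<partial>lborel) = (\<integral>\<^sup>+t. f (\<xi> + t *\<^sub>R b) \<partial>lborel)"
  by (subst (2) nn_integral_real_affine[of _ 1 s]) (simp_all add: scaleR_add_left add.assoc)

text \<open>On each line in the direction \<open>b\<close> the function \<open>u\<close> is at most a constant, the integral of \<open>G\<close> over that
line, so integrating \<open>u * \<psi>\<close> costs only the integral of \<open>\<psi>\<close>.\<close>

lemma nn_integral_mult_le_of_line_bound:
  fixes u \<psi> G :: "'a::euclidean_space \<Rightarrow> ennreal"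
  assumes b: "b \<in> Basis"
    and [measurable]: "u \<in> borel_measurable borel" "\<psi> \<in> borel_measurable borel" "G \<in> borel_measurable borel"
    and u: "\<And>\<xi>. u \<xi> \<le> (\<integral>\<^sup>+t. G (\<xi> + t *\<^sub>R b) \<partial>lborel)"
    and \<psi>: "\<And>\<xi>. (\<integral>\<^sup>+t. \<psi> (\<xi> + t *\<^sub>R b) \<partial>lborel) \<le> K"
  shows "(\<integral>\<^sup>+\<xi>. u \<xi> * \<psi> \<xi> \<partial>lborel) \<le> K * (\<integral>\<^sup>+\<xi>. G \<xi> \<partial>lborel)"
proof -
  have line: "(\<integral>\<^sup>+t. u (\<xi> + t *\<^sub>R b) * \<psi> (\<xi> + t *\<^sub>R b) \<partial>lborel) \<le> K * (\<integral>\<^sup>+t. G (\<xi> + t *\<^sub>R b) \<partial>lborel)" for \<xi>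
  proof -
    have "u (\<xi> + t *\<^sub>R b) \<le> (\<integral>\<^sup>+t. G (\<xi> + t *\<^sub>R b) \<partial>lborel)" for t
      using u[of "\<xi> + t *\<^sub>R b"] by (simp add: nn_integral_line_translate)
    then have "(\<integral>\<^sup>+t. u (\<xi> + t *\<^sub>R b) * \<psi> (\<xi> + t *\<^sub>R b) \<partial>lborel)
        \<le> (\<integral>\<^sup>+t. (\<integral>\<^sup>+t. G (\<xi> + t *\<^sub>R b) \<partial>lborel) * \<psi> (\<xi> + t *\<^sub>R b) \<partial>lborel)"
      by (intro nn_integral_mono mult_right_mono) auto
    also have "\<dots> = (\<integral>\<^sup>+t. G (\<xi> + t *\<^sub>R b) \<partial>lborel) * (\<integral>\<^sup>+t. \<psi> (\<xi> + t *\<^sub>R b) \<partial>lborel)"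
      by (intro nn_integral_cmult) measurable
    also have "\<dots> \<le> (\<integral>\<^sup>+t. G (\<xi> + t *\<^sub>R b) \<partial>lborel) * K"
      by (intro mult_left_mono \<psi>) auto
    finally show ?thesis
      by (simp add: mult.commute)
  qed
  let ?p = "\<lambda>z t. (\<Sum>i\<in>Basis - {b}. z i *\<^sub>R i) + t *\<^sub>R b"
  let ?M = "\<Pi>\<^sub>M i\<in>Basis - {b}. (lborel :: real measure)"
  have "(\<integral>\<^sup>+\<xi>. u \<xi> * \<psi> \<xi> \<partial>lborel) = (\<integral>\<^sup>+z. \<integral>\<^sup>+t. u (?p z t) * \<psi> (?p z t) \<partial>lborel \<partial>?M)"
    by (intro nn_integral_lborel_slice b) measurable
  also have "\<dots> \<le> (\<integral>\<^sup>+z. K * (\<integral>\<^sup>+t. G (?p z t) \<partial>lborel) \<partial>?M)"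
    by (intro nn_integral_mono line)
  also have "\<dots> = K * (\<integral>\<^sup>+\<xi>. G \<xi> \<partial>lborel)"
    by (subst nn_integral_cmult) (simp_all add: nn_integral_lborel_slice[OF b])
  finally show ?thesis .
qed

text \<open>The line integrals of \<open>H b\<close> do not depend on the coordinate \<open>b\<close>, so their product is controlled by
Finner's inequality. Admitting a separate function \<open>V b\<close> for each direction leaves room
for weights that vary with the direction.\<close>

lemma Gagliardo_inequality:
  fixes V H :: "'a::euclidean_space \<Rightarrow> 'a \<Rightarrow> ennreal"
  assumes dim: "2 \<le> DIM('a)"
    and [measurable]: "\<And>b. b \<in> Basis \<Longrightarrow> H b \<in> borel_measurable borel"
    and [measurable]: "\<And>b. b \<in> Basis \<Longrightarrow> V b \<in> borel_measurable borel"
    and V: "\<And>b \<xi>. b \<in> Basis \<Longrightarrow> V b \<xi> \<le> (\<integral>\<^sup>+t. H b (\<xi> + t *\<^sub>R b) \<partial>lborel)"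
  shows "(\<integral>\<^sup>+\<xi>. (\<Prod>b\<in>Basis. epowr (V b \<xi>) (1 / (DIM('a) - 1))) \<partial>lborel)
    \<le> (\<Prod>b\<in>Basis. epowr (\<integral>\<^sup>+\<xi>. H b \<xi> \<partial>lborel) (1 / (DIM('a) - 1)))"
proof -
  interpret product_sigma_finite "\<lambda>i::'a. lborel :: real measure" ..
  define c :: real where "c = 1 / (DIM('a) - 1)"
  have c: "0 < c"
    using dim by (simp add: c_def)
  define g where "g b z = (\<integral>\<^sup>+t. H b ((\<Sum>i\<in>Basis - {b}. z i *\<^sub>R i) + t *\<^sub>R b) \<partial>lborel)" for b z
  have g [measurable]: "g b \<in> borel_measurable (\<Pi>\<^sub>M i\<in>Basis - {b}. lborel)" if b: "b \<in> Basis" for b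
    using that unfolding g_def by measurable
  have V_le: "V b (\<Sum>i\<in>Basis. z i *\<^sub>R i) \<le> g b (restrict z (Basis - {b}))" if b: "b \<in> Basis" for b z
  proof -
    have "(\<Sum>i\<in>Basis. z i *\<^sub>R i) = (\<Sum>i\<in>Basis - {b}. z i *\<^sub>R i) + z b *\<^sub>R b"
      using b by (subst sum.remove[of _ b]) (auto simp: add.commute)
    then show ?thesis
      using V[OF b, of "\<Sum>i\<in>Basis. z i *\<^sub>R i"] b by (simp add: g_def nn_integral_line_translate)
  qed
  have "(\<integral>\<^sup>+\<xi>. (\<Prod>b\<in>Basis. epowr (V b \<xi>) c) \<partial>lborel)
      = (\<integral>\<^sup>+z. (\<Prod>b\<in>Basis. epowr (V b (\<Sum>i\<in>Basis. z i *\<^sub>R i)) c) \<partial>(\<Pi>\<^sub>M i\<in>(Basis::'a set). lborel))"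
    by (subst lborel_eq, subst nn_integral_distr)
      (auto intro!: borel_measurable_sum borel_measurable_prod_ennreal borel_measurable_epowr)
  also have "\<dots> \<le> (\<integral>\<^sup>+z. (\<Prod>b\<in>Basis. epowr (g b (restrict z (Basis - {b}))) c) \<partial>(\<Pi>\<^sub>M i\<in>(Basis::'a set). lborel))"
    using c by (intro nn_integral_mono prod_mono_ennreal epowr_mono V_le) auto
  also have "\<dots> \<le> (\<Prod>b\<in>Basis. epowr (\<integral>\<^sup>+z. g b z \<partial>(\<Pi>\<^sub>M i\<in>Basis - {b}. lborel)) c)"
  proof (intro Finner_inequality g)
    fix i :: 'a assume i: "i \<in> Basis"
    have "{e \<in> Basis. i \<in> Basis - {e}} = Basis - {i}"
      using i by auto
    then show "(\<Sum>e | e \<in> Basis \<and> i \<in> Basis - {e}. c) = 1"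
      using i dim by (simp add: c_def)
  qed (use c in auto)
  also have "\<dots> = (\<Prod>b\<in>Basis. epowr (\<integral>\<^sup>+\<xi>. H b \<xi> \<partial>lborel) c)"
    by (intro prod.cong refl arg_cong2[where f = epowr])
      (simp only: g_def nn_integral_lborel_slice[symmetric] assms(2))
  finally show ?thesis
    unfolding c_def .
qed

section \<open>Hardy's inequality in L1\<close>

lemma nn_integral_Poisson_kernel_le:
  fixes c a :: real
  assumes "0 \<le> c"
  shows "(\<integral>\<^sup>+t. ennreal (c / (c\<^sup>2 + (a + t)\<^sup>2)) \<partial>lborel) \<le> ennreal pi"
proof (cases "c = 0")
  case False
  with assms have c: "0 < c"
    by simp
  define h where "h t = c / (c\<^sup>2 + t\<^sup>2)" for t
  have h_nonneg: "0 \<le> h t" for t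
    using c by (simp add: h_def)
  have [measurable]: "h \<in> borel_measurable borel"
    unfolding h_def[abs_def] by measurable
  have deriv: "((\<lambda>t. arctan (t / c)) has_real_derivative h t) (at t)" for t
  proof -
    have "1 / c * (1 / (1 + (t / c)\<^sup>2)) = h t"
      using c by (simp add: h_def field_simps power2_eq_square)
    then show ?thesis
      using c by (auto intro!: derivative_eq_intros simp: field_simps)
  qed
  have "filterlim (\<lambda>t. t / c) at_top at_top"
    using c by (auto intro!: filterlim_tendsto_pos_mult_at_top[where c = "1 / c"] filterlim_ident simp: divide_inverse mult.commute[of _ "inverse c"])
  then have lim: "((\<lambda>t. arctan (t / c)) \<longlongrightarrow> pi / 2) at_top"
    by (rule filterlim_compose[OF tendsto_arctan_at_top])
  have half: "(\<integral>\<^sup>+t. ennreal (h t) * indicator {0..} t \<partial>lborel) = ennreal (pi / 2)"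
    using nn_integral_FTC_atLeast[OF _ deriv h_nonneg lim, of 0] by simp
  have "(\<integral>\<^sup>+t. ennreal (h t) \<partial>lborel)
      \<le> (\<integral>\<^sup>+t. ennreal (h t) * indicator {0..} t + ennreal (h (- t)) * indicator {0..} (- t) \<partial>lborel)"
    by (intro nn_integral_mono) (auto simp: h_def indicator_def)
  also have "\<dots> = (\<integral>\<^sup>+t. ennreal (h t) * indicator {0..} t \<partial>lborel)
      + (\<integral>\<^sup>+t. ennreal (h (- t)) * indicator {0..} (- t) \<partial>lborel)"
    by (intro nn_integral_add) measurable
  also have "(\<integral>\<^sup>+t. ennreal (h (- t)) * indicator {0..} (- t) \<partial>lborel)
      = (\<integral>\<^sup>+t. ennreal (h t) * indicator {0..} t \<partial>lborel)"
    by (subst (2) nn_integral_real_affine[of _ "-1" 0]) simp_all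
  also have "(\<integral>\<^sup>+t. ennreal (h t) * indicator {0..} t \<partial>lborel) + \<dots> = ennreal pi"
    by (simp add: half flip: ennreal_plus)
  finally have "(\<integral>\<^sup>+t. ennreal (h t) \<partial>lborel) \<le> ennreal pi" .
  moreover have "(\<integral>\<^sup>+t. ennreal (h t) \<partial>lborel) = (\<integral>\<^sup>+t. ennreal (h (a + t)) \<partial>lborel)"
    by (subst nn_integral_real_affine[of _ 1 a]) simp_all
  ultimately show ?thesis
    by (simp add: h_def)
qed simp

lemma inner_Basis_square_le:
  fixes x :: "'b::euclidean_space"
  assumes "e \<in> Basis"
  shows "(x \<bullet> e)\<^sup>2 \<le> (norm x)\<^sup>2"
  using Basis_le_norm[OF assms, of x] by (simp flip: abs_le_square_iff)

text \<open>The vectors with entries \<open>sqrt ((norm x)\<^sup>2 - (x \<bullet> e)\<^sup>2)\<close> have squared Euclidean length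
\<open>(DIM('b) - 1) * (norm x)\<^sup>2\<close>, and the Euclidean length is at most the sum of the entries. The dimension
must be at least 2: on the line the sum is 0.\<close>

lemma inverse_norm_le_sum_Poisson_kernels:
  fixes x :: "'b::euclidean_space"
  assumes dim: "2 \<le> DIM('b)"
  shows "1 / norm x \<le> (\<Sum>e\<in>Basis. sqrt ((norm x)\<^sup>2 - (x \<bullet> e)\<^sup>2) / (norm x)\<^sup>2)"
proof -
  have nonneg: "0 \<le> (norm x)\<^sup>2 - (x \<bullet> e)\<^sup>2" if "e \<in> Basis" for e
    using inner_Basis_square_le[OF that, of x] by simp
  have "(norm x)\<^sup>2 = (\<Sum>e\<in>Basis. (x \<bullet> e)\<^sup>2)"
    unfolding power2_norm_eq_inner by (subst euclidean_inner) (simp add: power2_eq_square)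
  then have "(\<Sum>e\<in>Basis. (norm x)\<^sup>2 - (x \<bullet> e)\<^sup>2) = (DIM('b) - 1) * (norm x)\<^sup>2"
    using dim by (simp add: sum_subtractf algebra_simps of_nat_diff)
  moreover have "1 * (norm x)\<^sup>2 \<le> (DIM('b) - 1) * (norm x)\<^sup>2"
    using dim by (intro mult_right_mono) auto
  ultimately have "(norm x)\<^sup>2 \<le> (\<Sum>e\<in>Basis. (norm x)\<^sup>2 - (x \<bullet> e)\<^sup>2)"
    by simp
  then have "norm x \<le> sqrt (\<Sum>e\<in>Basis. (norm x)\<^sup>2 - (x \<bullet> e)\<^sup>2)"
    by (simp add: real_le_rsqrt)
  also have "\<dots> = L2_set (\<lambda>e. sqrt ((norm x)\<^sup>2 - (x \<bullet> e)\<^sup>2)) Basis"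
    using nonneg by (simp add: L2_set_def cong: sum.cong)
  also have "\<dots> \<le> (\<Sum>e\<in>Basis. sqrt ((norm x)\<^sup>2 - (x \<bullet> e)\<^sup>2))"
    using nonneg by (intro L2_set_le_sum) auto
  finally have "norm x / (norm x)\<^sup>2 \<le> (\<Sum>e\<in>Basis. sqrt ((norm x)\<^sup>2 - (x \<bullet> e)\<^sup>2)) / (norm x)\<^sup>2"
    by (rule divide_right_mono) simp
  moreover have "norm x / (norm x)\<^sup>2 = 1 / norm x"
    by (cases "x = 0") (simp_all add: power2_eq_square)
  ultimately show ?thesis
    by (simp only: sum_divide_distrib)
qed

text \<open>The weight \<open>1 / norm x\<close> is dominated by a sum of one weight per direction. In terms of the distance
\<open>c\<close> of the origin to the line through \<open>x\<close> in the direction \<open>e\<close>, the weight belonging to \<open>e\<close> is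
\<open>c / (c\<^sup>2 + s\<^sup>2)\<close> at the point of that line with coordinate \<open>s\<close>, so its integral over every such line
is at most \<open>pi\<close>, whatever \<open>c\<close> is.\<close>

lemma Hardy_inequality_L1:
  fixes u G :: "'b::euclidean_space \<times> 'c::euclidean_space \<Rightarrow> ennreal"
  assumes dim: "2 \<le> DIM('b)"
    and [measurable]: "u \<in> borel_measurable borel" "G \<in> borel_measurable borel"
    and u: "\<And>e \<xi>. e \<in> Basis \<Longrightarrow> u \<xi> \<le> (\<integral>\<^sup>+t. G (\<xi> + t *\<^sub>R (e, 0)) \<partial>lborel)"
  shows "(\<integral>\<^sup>+\<xi>. u \<xi> * ennreal (1 / norm (fst \<xi>)) \<partial>lborel)
    \<le> ennreal (DIM('b) * pi) * (\<integral>\<^sup>+\<xi>. G \<xi> \<partial>lborel)"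
proof -
  define \<psi> :: "'b \<Rightarrow> 'b \<times> 'c \<Rightarrow> real"
    where "\<psi> e \<xi> = sqrt ((norm (fst \<xi>))\<^sup>2 - (fst \<xi> \<bullet> e)\<^sup>2) / (norm (fst \<xi>))\<^sup>2" for e \<xi>
  have \<psi>_nonneg: "0 \<le> \<psi> e \<xi>" if "e \<in> Basis" for e \<xi>
    using inner_Basis_square_le[OF that, of "fst \<xi>"] by (simp add: \<psi>_def)
  have [measurable]: "\<psi> e \<in> borel_measurable borel" for e
    unfolding \<psi>_def[abs_def] by (simp add: borel_prod[symmetric])
  have direction: "(\<integral>\<^sup>+\<xi>. u \<xi> * ennreal (\<psi> e \<xi>) \<partial>lborel) \<le> ennreal pi * (\<integral>\<^sup>+\<xi>. G \<xi> \<partial>lborel)"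
    if e: "e \<in> Basis" for e
  proof (rule nn_integral_mult_le_of_line_bound)
    show "(e, 0) \<in> Basis"
      using e by (simp add: Basis_prod_def)
    show "(\<integral>\<^sup>+t. ennreal (\<psi> e (\<xi> + t *\<^sub>R (e, 0))) \<partial>lborel) \<le> ennreal pi" for \<xi>
    proof -
      define x c where "x = fst \<xi>" and "c = sqrt ((norm x)\<^sup>2 - (x \<bullet> e)\<^sup>2)"
      have c2: "c\<^sup>2 = (norm x)\<^sup>2 - (x \<bullet> e)\<^sup>2"
        using inner_Basis_square_le[OF e, of x] by (simp add: c_def)
      have "\<psi> e (\<xi> + t *\<^sub>R (e, 0)) = c / (c\<^sup>2 + (x \<bullet> e + t)\<^sup>2)" for t
      proof -
        have n: "(norm (x + t *\<^sub>R e))\<^sup>2 = c\<^sup>2 + (x \<bullet> e + t)\<^sup>2"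
          unfolding c2 power2_norm_eq_inner using e
          by (simp add: inner_add_left inner_add_right inner_commute[of e x] power2_eq_square distrib_left distrib_right)
        have "(x + t *\<^sub>R e) \<bullet> e = x \<bullet> e + t"
          using e by (simp add: inner_simps)
        then have "(norm (x + t *\<^sub>R e))\<^sup>2 - ((x + t *\<^sub>R e) \<bullet> e)\<^sup>2 = c\<^sup>2"
          by (simp add: n)
        moreover have "0 \<le> c"
          using inner_Basis_square_le[OF e, of x] by (simp add: c_def)
        ultimately show ?thesis
          using n by (simp add: \<psi>_def x_def)
      qed
      moreover have "0 \<le> c"
        using inner_Basis_square_le[OF e, of x] by (simp add: c_def)
      ultimately show ?thesis
        using nn_integral_Poisson_kernel_le[of c "x \<bullet> e"] by simp
    qed
  qed (use u e in measurable)
  have "(\<integral>\<^sup>+\<xi>. u \<xi> * ennreal (1 / norm (fst \<xi>)) \<partial>lborel)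
      \<le> (\<integral>\<^sup>+\<xi>. (\<Sum>e\<in>Basis. u \<xi> * ennreal (\<psi> e \<xi>)) \<partial>lborel)"
  proof (intro nn_integral_mono)
    fix \<xi> :: "'b \<times> 'c"
    have "ennreal (1 / norm (fst \<xi>)) \<le> ennreal (\<Sum>e\<in>Basis. \<psi> e \<xi>)"
      unfolding \<psi>_def by (intro ennreal_leI inverse_norm_le_sum_Poisson_kernels dim)
    also have "\<dots> = (\<Sum>e\<in>Basis. ennreal (\<psi> e \<xi>))"
      by (simp add: \<psi>_nonneg)
    finally show "u \<xi> * ennreal (1 / norm (fst \<xi>)) \<le> (\<Sum>e\<in>Basis. u \<xi> * ennreal (\<psi> e \<xi>))"
      by (simp add: mult_left_mono flip: sum_distrib_left)
  qed
  also have "\<dots> = (\<Sum>e\<in>Basis. \<integral>\<^sup>+\<xi>. u \<xi> * ennreal (\<psi> e \<xi>) \<partial>lborel)"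
    by (intro nn_integral_sum) measurable
  also have "\<dots> \<le> (\<Sum>e\<in>(Basis :: 'b set). ennreal pi * (\<integral>\<^sup>+\<xi>. G \<xi> \<partial>lborel))"
    by (intro sum_mono direction)
  also have "\<dots> = ennreal (DIM('b) * pi) * (\<integral>\<^sup>+\<xi>. G \<xi> \<partial>lborel)"
    by (simp add: ennreal_mult ennreal_of_nat_eq_real_of_nat mult.assoc)
  finally show ?thesis .
qed

section \<open>The inequality for exponent 1\<close>

lemma AE_lborel_fst_nonzero: "AE \<xi> in lborel. fst (\<xi> :: 'b::euclidean_space \<times> 'c::euclidean_space) \<noteq> 0"
proof -
  obtain e :: 'b where e: "e \<in> Basis"
    using nonempty_Basis by blast
  let ?S = "{\<xi> :: 'b \<times> 'c. (e, 0) \<bullet> \<xi> = 0}"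
  have "negligible ?S"
    using e by (intro negligible_hyperplane) (auto simp: prod_eq_iff)
  moreover have "?S \<in> sets lborel"
    by measurable
  ultimately have "?S \<in> null_sets lborel"
    by (simp add: negligible_iff_null_sets null_sets_completion_iff)
  then have "AE \<xi> in lborel. \<xi> \<notin> ?S"
    by (rule AE_not_in)
  then show ?thesis
    by eventually_elim (auto simp: inner_prod_def)
qed

text \<open>Here \<open>G\<close> stands for the length of the Grushin gradient of \<open>u\<close>, and the line bounds are what ties it to \<open>u\<close>.
With \<open>N = n + m\<close>, Gagliardo's inequality bounds the integral of
\<open>(u powr N * norm x powr (m * \<beta>)) powr (1 / (N - 1))\<close>, because the vertical factor
\<open>norm x powr \<beta>\<close> is constant on vertical lines, and Hardy's inequality bounds that of \<open>u / norm x\<close>.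
Hoelder's inequality with weights \<open>\<theta> = (N - 1) / (Q - 1)\<close> and \<open>1 - \<theta> = m * \<beta> / (Q - 1)\<close> combines
them: the powers of \<open>norm x\<close> cancel, and those of \<open>u\<close> add up to \<open>Q / (Q - 1)\<close>, as \<open>Q = N + m * \<beta>\<close>.\<close>

theorem Grushin_Sobolev_L1:
  fixes u :: "'b::euclidean_space \<times> 'c::euclidean_space \<Rightarrow> real"
    and G :: "'b \<times> 'c \<Rightarrow> ennreal"
    and \<beta> Q :: real
  assumes dim: "2 \<le> DIM('b)" and \<beta>: "0 < \<beta>"
    and Q: "Q = real DIM('b) + real DIM('c) * (\<beta> + 1)"
    and [measurable]: "u \<in> borel_measurable borel" "G \<in> borel_measurable borel"
    and u_nonneg: "\<And>\<xi>. 0 \<le> u \<xi>"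
    and horizontal: "\<And>e \<xi>. e \<in> Basis \<Longrightarrow> ennreal (u \<xi>) \<le> (\<integral>\<^sup>+t. G (\<xi> + t *\<^sub>R (e, 0)) \<partial>lborel)"
    and vertical: "\<And>e \<xi>. e \<in> Basis \<Longrightarrow>
      ennreal (norm (fst \<xi>) powr \<beta> * u \<xi>) \<le> (\<integral>\<^sup>+t. G (\<xi> + t *\<^sub>R (0, e)) \<partial>lborel)"
  shows "(\<integral>\<^sup>+\<xi>. ennreal (u \<xi> powr (Q / (Q - 1))) \<partial>lborel)
    \<le> ennreal ((DIM('b) * pi) powr (DIM('c) * \<beta> / (Q - 1))) * epowr (\<integral>\<^sup>+\<xi>. G \<xi> \<partial>lborel) (Q / (Q - 1))"
proof -
  define n m :: real where "n = real DIM('b)" and "m = real DIM('c)"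
  define \<theta> where "\<theta> = (n + m - 1) / (Q - 1)"
  define c where "c = 1 / (n + m - 1)"
  define A where "A = (\<integral>\<^sup>+\<xi>. G \<xi> \<partial>lborel)"
  have n: "2 \<le> n" and m: "1 \<le> m"
    using dim by (auto simp: n_def m_def Suc_le_eq)
  have Q': "Q = n + m + m * \<beta>"
    by (simp add: Q n_def m_def algebra_simps)
  have m\<beta>: "0 < m * \<beta>"
    using m \<beta> by simp
  have Q1: "0 < Q - 1" and N1: "0 < n + m - 1"
    using n m m\<beta> by (simp_all add: Q')
  have \<theta>: "0 < \<theta>" "0 < 1 - \<theta>" "1 - \<theta> = m * \<beta> / (Q - 1)" and c\<theta>: "c * \<theta> = 1 / (Q - 1)"
    using Q1 N1 m\<beta> by (auto simp: \<theta>_def c_def Q' field_simps)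
  have c_eq: "c = 1 / (DIM('b \<times> 'c) - 1)"
    using n m by (simp add: c_def n_def m_def of_nat_diff)
  have c: "0 < c"
    using N1 by (simp add: c_def)

  \<comment> \<open>A basis vector is vertical precisely if its second component is not 0.\<close>
  define V where "V b \<xi> = ennreal ((if snd b = 0 then 1 else norm (fst \<xi>) powr \<beta>) * u \<xi>)" for b \<xi> :: "'b \<times> 'c"
  define X where "X \<xi> = (\<Prod>b\<in>Basis. epowr (V b \<xi>) c)" for \<xi>
  define Y where "Y \<xi> = ennreal (u \<xi>) * ennreal (1 / norm (fst \<xi>))" for \<xi>
  have [measurable]: "fst \<in> borel_measurable (borel :: ('b \<times> 'c) measure)"
    by (intro borel_measurable_continuous_onI continuous_intros)
  have [measurable]: "V b \<in> borel_measurable borel" for b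
    unfolding V_def[abs_def] by measurable
  have [measurable]: "X \<in> borel_measurable borel"
    unfolding X_def[abs_def] by measurable
  have [measurable]: "Y \<in> borel_measurable borel"
    unfolding Y_def[abs_def] by measurable

  have "(\<integral>\<^sup>+\<xi>. X \<xi> \<partial>lborel) \<le> (\<Prod>b\<in>(Basis :: ('b \<times> 'c) set). epowr A c)"
    unfolding X_def A_def c_eq
  proof (rule Gagliardo_inequality)
    fix b \<xi> :: "'b \<times> 'c" assume "b \<in> Basis"
    then consider e where "e \<in> Basis" "b = (e, 0)" | e where "e \<in> Basis" "b = (0, e)"
      by (auto simp: Basis_prod_def)
    then show "V b \<xi> \<le> (\<integral>\<^sup>+t. G (\<xi> + t *\<^sub>R b) \<partial>lborel)"
      by cases (use horizontal vertical in \<open>auto simp: V_def\<close>)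
  qed (use dim in auto)
  also have "\<dots> = epowr A ((n + m) * c)"
    using n m epowr_of_nat[of "DIM('b \<times> 'c)" "epowr A c"]
    by (simp add: epowr_epowr n_def m_def mult.commute)
  finally have X: "(\<integral>\<^sup>+\<xi>. X \<xi> \<partial>lborel) \<le> epowr A ((n + m) * c)" .

  have Y: "(\<integral>\<^sup>+\<xi>. Y \<xi> \<partial>lborel) \<le> ennreal (n * pi) * A"
    unfolding Y_def A_def n_def using horizontal by (intro Hardy_inequality_L1 dim) auto

  have X_eq: "X \<xi> = ennreal (u \<xi> powr ((n + m) * c) * norm (fst \<xi>) powr (m * \<beta> * c))" for \<xi>
  proof -
    have "(\<Prod>b\<in>Basis. V b \<xi>) = (\<Prod>e\<in>(Basis::'b set). ennreal (u \<xi>)) * (\<Prod>e\<in>(Basis::'c set). ennreal (norm (fst \<xi>) powr \<beta> * u \<xi>))"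
      unfolding Basis_prod_def
      by (subst prod.union_disjoint) (auto simp: prod.reindex inj_on_def V_def nonzero_Basis cong: prod.cong)
    also have "\<dots> = ennreal (u \<xi> ^ DIM('b) * (norm (fst \<xi>) powr \<beta> * u \<xi>) ^ DIM('c))"
      using u_nonneg by (simp add: ennreal_power flip: ennreal_mult)
    finally have "X \<xi> = ennreal ((u \<xi> ^ DIM('b) * (norm (fst \<xi>) powr \<beta> * u \<xi>) ^ DIM('c)) powr c)"
      unfolding X_def epowr_prod[symmetric] using u_nonneg by (simp add: epowr_ennreal)
    also have "u \<xi> ^ DIM('b) * (norm (fst \<xi>) powr \<beta> * u \<xi>) ^ DIM('c)
        = u \<xi> powr (n + m) * norm (fst \<xi>) powr (m * \<beta>)"
      using u_nonneg[of \<xi>]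
      by (simp add: powr_realpow' powr_add n_def m_def power_mult_distrib powr_powr
          mult.commute[of _ \<beta>] flip: powr_powr)
    finally show ?thesis
      using u_nonneg by (simp add: powr_mult powr_powr)
  qed

  have "AE \<xi> in lborel. ennreal (u \<xi> powr (Q / (Q - 1))) = epowr (X \<xi>) \<theta> * epowr (Y \<xi>) (1 - \<theta>)"
    using AE_lborel_fst_nonzero
  proof eventually_elim
    case (elim \<xi>)
    have "epowr (X \<xi>) \<theta> = ennreal (u \<xi> powr ((n + m) / (Q - 1)) * norm (fst \<xi>) powr (1 - \<theta>))"
      unfolding X_eq using u_nonneg c\<theta>
      by (simp add: epowr_ennreal powr_mult powr_powr mult.assoc \<theta>(3))
    moreover have "epowr (Y \<xi>) (1 - \<theta>) = ennreal (u \<xi> powr (m * \<beta> / (Q - 1)) * (1 / norm (fst \<xi>)) powr (1 - \<theta>))"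
      unfolding Y_def using u_nonneg by (simp add: epowr_ennreal powr_divide \<theta>(3) flip: ennreal_mult)
    moreover have "norm (fst \<xi>) powr (1 - \<theta>) * (1 / norm (fst \<xi>)) powr (1 - \<theta>) = 1"
      using elim by (simp flip: powr_mult)
    moreover have "u \<xi> powr ((n + m) / (Q - 1)) * u \<xi> powr (m * \<beta> / (Q - 1)) = u \<xi> powr (Q / (Q - 1))"
      by (simp add: Q' add_divide_distrib flip: powr_add)
    ultimately show ?case
      using u_nonneg by (simp flip: ennreal_mult) (simp add: mult_ac)
  qed
  then have "(\<integral>\<^sup>+\<xi>. ennreal (u \<xi> powr (Q / (Q - 1))) \<partial>lborel) = (\<integral>\<^sup>+\<xi>. epowr (X \<xi>) \<theta> * epowr (Y \<xi>) (1 - \<theta>) \<partial>lborel)"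
    by (rule nn_integral_cong_AE)
  also have "\<dots> \<le> epowr (\<integral>\<^sup>+\<xi>. X \<xi> \<partial>lborel) \<theta> * epowr (\<integral>\<^sup>+\<xi>. Y \<xi> \<partial>lborel) (1 - \<theta>)"
    using \<theta> by (intro nn_integral_Holder_pair) auto
  also have "\<dots> \<le> epowr (epowr A ((n + m) * c)) \<theta> * epowr (ennreal (n * pi) * A) (1 - \<theta>)"
    using \<theta> by (intro mult_mono epowr_mono X Y) auto
  also have "\<dots> = epowr (ennreal (n * pi)) (1 - \<theta>) * (epowr A ((n + m) / (Q - 1)) * epowr A (m * \<beta> / (Q - 1)))"
    using c\<theta> by (simp only: epowr_epowr epowr_mult mult.assoc \<theta>(3)) (simp add: mult_ac)
  also have "epowr A ((n + m) / (Q - 1)) * epowr A (m * \<beta> / (Q - 1)) = epowr A (Q / (Q - 1))"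
    by (simp add: Q' add_divide_distrib flip: epowr_add)
  finally show ?thesis
    by (simp add: A_def \<theta>(3) n_def m_def epowr_ennreal)
qed

section \<open>Line integrals of derivatives\<close>

lemma norm_le_nn_integral_derivative:
  fixes h :: "real \<Rightarrow> 'b::real_normed_vector"
  assumes deriv: "\<And>t. (h has_vector_derivative h' t) (at t)"
    and bound: "\<And>t. norm (h' t) \<le> g t"
    and cont: "continuous_on UNIV g"
    and T: "T < s" "h T = 0"
  shows "ennreal (norm (h s)) \<le> (\<integral>\<^sup>+t. ennreal (g t) \<partial>lborel)"
proof -
  have g: "0 \<le> g t" for t
    using bound[of t] norm_ge_zero order_trans by blast
  have cont': "continuous_on S g" for S
    using cont continuous_on_subset by blast
  define \<phi> where "\<phi> r = integral {T..r} g" for r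
  have \<phi>: "(\<phi> has_vector_derivative g r) (at r)" if "T < r" "r < s" for r
  proof -
    have "(\<phi> has_vector_derivative g r) (at r within {T..s})"
      unfolding \<phi>_def using that by (intro integral_has_vector_derivative cont') auto
    then show ?thesis
      using that by (simp add: at_within_Icc_at)
  qed
  have "norm (h s - h T) \<le> \<phi> s - \<phi> T"
  proof (rule differentiable_bound_general)
    show "continuous_on {T..s} h"
      using deriv by (intro continuous_at_imp_continuous_on ballI)
        (blast intro: has_vector_derivative_continuous)
    show "continuous_on {T..s} \<phi>"
      unfolding \<phi>_def by (intro indefinite_integral_continuous_1 integrable_continuous_interval cont')
  qed (use T \<phi> deriv bound in auto)
  then have "ennreal (norm (h s)) \<le> ennreal (integral {T..s} g)"
    using T by (intro ennreal_leI) (simp add: \<phi>_def)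
  also have "\<dots> = (\<integral>\<^sup>+t. ennreal (g t) * indicator {T..s} t \<partial>lborel)"
    by (intro nn_integral_has_integral_lebesgue'[symmetric] integrable_integral
        integrable_continuous_interval cont' g)
  also have "\<dots> \<le> (\<integral>\<^sup>+t. ennreal (g t) \<partial>lborel)"
    using g by (intro nn_integral_mono) (auto simp: indicator_def)
  finally show ?thesis .
qed

lemma has_vector_derivative_along_line:
  fixes f :: "'a::real_normed_vector \<Rightarrow> 'b::real_normed_vector"
  assumes "f differentiable (at (\<xi> + t *\<^sub>R b))"
  shows "((\<lambda>s. f (\<xi> + s *\<^sub>R b)) has_vector_derivative partial_deriv b f (\<xi> + t *\<^sub>R b)) (at t)"
proof -
  obtain D where D: "(f has_derivative D) (at (\<xi> + t *\<^sub>R b))"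
    using assms by (auto simp: differentiable_def)
  have line: "((\<lambda>s. \<eta> + s *\<^sub>R b) has_derivative (\<lambda>s. s *\<^sub>R b)) (at r)" for \<eta> r
    by (auto intro!: derivative_eq_intros)
  have lin: "(\<lambda>s. D (s *\<^sub>R b)) = (\<lambda>s. s *\<^sub>R D b)"
    using D by (simp add: linear_cmul has_derivative_linear)
  have "((\<lambda>s. f ((\<xi> + t *\<^sub>R b) + s *\<^sub>R b)) has_vector_derivative D b) (at 0)"
    using has_derivative_compose[OF line[of "\<xi> + t *\<^sub>R b" 0], of f D] D
    by (simp add: has_vector_derivative_def lin)
  then have "partial_deriv b f (\<xi> + t *\<^sub>R b) = D b"
    unfolding partial_deriv_def by (rule vector_derivative_at)
  then show ?thesis
    using has_derivative_compose[OF line[of \<xi> t] D]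
    by (simp add: has_vector_derivative_def lin)
qed

text \<open>At a zero of \<open>F\<close> the norm itself may have a corner, but the difference quotient of its power is the
bounded difference quotient of \<open>F\<close> times \<open>norm (F s) powr (\<gamma> - 1)\<close>, which tends to 0.\<close>

lemma norm_powr_has_real_derivative:
  fixes F :: "real \<Rightarrow> 'b::real_inner"
  assumes F: "(F has_vector_derivative F') (at t)" and \<gamma>: "1 < \<gamma>"
  shows "\<exists>d. ((\<lambda>s. norm (F s) powr \<gamma>) has_real_derivative d) (at t)
    \<and> \<bar>d\<bar> \<le> \<gamma> * norm (F t) powr (\<gamma> - 1) * norm F'"
proof (cases "F t = 0")
  case False
  have "((\<lambda>s. norm (F s)) has_derivative (\<lambda>h. (h *\<^sub>R F') \<bullet> sgn (F t))) (at t)"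
    using has_derivative_compose[OF F[unfolded has_vector_derivative_def] has_derivative_norm[OF False]] .
  then have "((\<lambda>s. norm (F s)) has_real_derivative (F' \<bullet> sgn (F t))) (at t)"
    by (rule has_derivative_imp_has_field_derivative) simp
  then have "((\<lambda>s. norm (F s) powr \<gamma>) has_real_derivative
      \<gamma> * norm (F t) powr (\<gamma> - 1) * (F' \<bullet> sgn (F t))) (at t)"
    using DERIV_fun_powr[of "\<lambda>s. norm (F s)" "F' \<bullet> sgn (F t)" t \<gamma>] False by simp
  moreover have "\<bar>F' \<bullet> sgn (F t)\<bar> \<le> norm F'"
    using Cauchy_Schwarz_ineq2[of F' "sgn (F t)"] False by (simp add: norm_sgn)
  ultimately show ?thesis
    using \<gamma> by (intro exI[of _ "\<gamma> * norm (F t) powr (\<gamma> - 1) * (F' \<bullet> sgn (F t))"])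
      (auto simp: abs_mult intro!: mult_left_mono)
next
  case True
  have quot: "((\<lambda>s. (F s - F t) /\<^sub>R (s - t)) \<longlongrightarrow> F') (at t)"
  proof (rule LIM_zero_cancel, rule tendsto_norm_zero_cancel, rule Lim_transform_eventually)
    show "((\<lambda>s. norm (F s - F t - (s - t) *\<^sub>R F') / norm (s - t)) \<longlongrightarrow> 0) (at t)"
      using F by (simp add: has_vector_derivative_def has_derivative_iff_norm)
    have "norm (F s - F t - (s - t) *\<^sub>R F') / norm (s - t) = norm ((F s - F t) /\<^sub>R (s - t) - F')"
      if "s \<noteq> t" for s
    proof -
      have "(F s - F t) /\<^sub>R (s - t) - F' = (F s - F t - (s - t) *\<^sub>R F') /\<^sub>R (s - t)"
        using that by (simp add: scaleR_diff_right)
      then show ?thesis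
        by (simp only: norm_scaleR) (simp add: divide_inverse mult.commute)
    qed
    then show "\<forall>\<^sub>F s in at t. norm (F s - F t - (s - t) *\<^sub>R F') / norm (s - t)
        = norm ((F s - F t) /\<^sub>R (s - t) - F')"
      by (simp add: eventually_at_filter)
  qed
  have "((\<lambda>s. norm (F s)) \<longlongrightarrow> norm (F t)) (at t)"
    using has_vector_derivative_continuous[OF F] by (intro tendsto_norm) (simp add: isCont_def)
  then have "((\<lambda>s. norm (F s) powr (\<gamma> - 1)) \<longlongrightarrow> 0) (at t)"
    using tendsto_powr'[OF _ tendsto_const, of "\<lambda>s. norm (F s)" 0 "at t" "\<gamma> - 1"] \<gamma> True by simp
  then have "((\<lambda>s. norm (F s) powr (\<gamma> - 1) * norm ((F s - F t) /\<^sub>R (s - t))) \<longlongrightarrow> 0 * norm F') (at t)"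
    by (intro tendsto_mult tendsto_norm quot)
  moreover have "norm (F s) powr (\<gamma> - 1) * norm ((F s - F t) /\<^sub>R (s - t))
      = norm ((norm (F s) powr \<gamma> - norm (F t) powr \<gamma>) / (s - t))" for s
    using True \<gamma> by (cases "F s = 0") (simp_all add: powr_diff divide_inverse abs_mult mult.commute)
  ultimately have "((\<lambda>s. (norm (F s) powr \<gamma> - norm (F t) powr \<gamma>) / (s - t)) \<longlongrightarrow> 0) (at t)"
    by (subst tendsto_norm_zero_iff[symmetric]) (simp only: mult_zero_left)
  then have "((\<lambda>s. norm (F s) powr \<gamma>) has_real_derivative 0) (at t)"
    by (simp add: has_field_derivative_iff)
  then show ?thesis
    using \<gamma> by (intro exI[of _ 0]) auto
qed

lemma partial_deriv_eq_0_outside_support: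
  fixes f :: "'a::real_normed_vector \<Rightarrow> 'b::real_normed_vector"
  assumes "\<xi> \<notin> closure {\<xi>. f \<xi> \<noteq> 0}"
  shows "partial_deriv b f \<xi> = 0"
proof -
  let ?U = "- closure {\<xi>. f \<xi> \<noteq> 0}"
  have "((\<lambda>t. \<xi> + t *\<^sub>R b) \<longlongrightarrow> \<xi>) (nhds 0)"
    by (auto intro!: tendsto_eq_intros filterlim_ident)
  then have "\<forall>\<^sub>F t in nhds 0. \<xi> + t *\<^sub>R b \<in> ?U"
    using assms by (intro topological_tendstoD) auto
  then have "\<forall>\<^sub>F t in nhds 0. f (\<xi> + t *\<^sub>R b) = 0"
    by eventually_elim (use closure_subset[of "{\<xi>. f \<xi> \<noteq> 0}"] in auto)
  then have "vector_derivative (\<lambda>t. f (\<xi> + t *\<^sub>R b)) (at 0) = vector_derivative (\<lambda>t. 0) (at 0)"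
    by (intro vector_derivative_cong_eq) auto
  then show ?thesis
    by (simp add: partial_deriv_def)
qed

lemma integrable_continuous_compact_support:
  fixes g :: "'a::euclidean_space \<Rightarrow> real"
  assumes "continuous_on UNIV g" "compact S" "\<And>\<xi>. \<xi> \<notin> S \<Longrightarrow> g \<xi> = 0"
  shows "integrable lborel g"
proof -
  have "integrable lborel (\<lambda>\<xi>. indicator S \<xi> *\<^sub>R g \<xi>)"
    using assms by (intro borel_integrable_compact) (auto intro: continuous_on_subset)
  also have "(\<lambda>\<xi>. indicator S \<xi> *\<^sub>R g \<xi>) = g"
    using assms(3) by (auto simp: indicator_def fun_eq_iff)
  finally show ?thesis .
qed

lemma exists_zero_on_line:
  fixes f :: "'a::real_normed_vector \<Rightarrow> 'b::zero"
  assumes "compact (closure {\<xi>. f \<xi> \<noteq> 0})" "b \<noteq> 0"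
  shows "\<exists>T<s. f (\<xi> + T *\<^sub>R b) = 0"
proof -
  obtain R where R: "norm \<eta> \<le> R" if "f \<eta> \<noteq> 0" for \<eta>
    using compact_imp_bounded[OF assms(1)] closure_subset[of "{\<xi>. f \<xi> \<noteq> 0}"]
    unfolding bounded_iff by blast
  define T where "T = min (s - 1) (- ((\<bar>R\<bar> + norm \<xi> + 1) / norm b))"
  have "T \<le> - ((\<bar>R\<bar> + norm \<xi> + 1) / norm b)"
    by (simp only: T_def min.cobounded2)
  then have "(\<bar>R\<bar> + norm \<xi> + 1) / norm b \<le> \<bar>T\<bar>"
    by linarith
  then have "\<bar>R\<bar> + norm \<xi> + 1 \<le> norm (T *\<^sub>R b)"
    using assms(2) by (simp add: field_simps)
  then have "R < norm (\<xi> + T *\<^sub>R b)"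
    using norm_triangle_ineq2[of "T *\<^sub>R b" "- \<xi>"] by (simp add: add.commute)
  then have "f (\<xi> + T *\<^sub>R b) = 0"
    using R by fastforce
  moreover have "T < s"
    by (simp add: T_def)
  ultimately show ?thesis
    by blast
qed

text \<open>The function \<open>h\<close> is a chain-rule image of \<open>f\<close>, such as \<open>f\<close> itself or a power of its norm, and \<open>k\<close>
bounds the factor that the chain rule produces.\<close>

lemma norm_le_line_integral:
  fixes f :: "'a::euclidean_space \<Rightarrow> 'b::real_normed_vector" and h :: "'a \<Rightarrow> 'c::real_normed_vector"
  assumes supp: "compact (closure {\<xi>. f \<xi> \<noteq> 0})"
    and b: "b \<in> Basis"
    and cont: "continuous_on UNIV (partial_deriv b f)" "continuous_on UNIV k"
    and zero: "\<And>\<xi>. f \<xi> = 0 \<Longrightarrow> h \<xi> = 0"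
    and deriv: "\<And>t. \<exists>d. ((\<lambda>s. h (\<xi> + s *\<^sub>R b)) has_vector_derivative d) (at t)
      \<and> norm d \<le> k (\<xi> + t *\<^sub>R b) * norm (partial_deriv b f (\<xi> + t *\<^sub>R b))"
  shows "ennreal (norm (h \<xi>))
    \<le> (\<integral>\<^sup>+t. ennreal (k (\<xi> + t *\<^sub>R b) * norm (partial_deriv b f (\<xi> + t *\<^sub>R b))) \<partial>lborel)"
proof -
  obtain d where d: "((\<lambda>s. h (\<xi> + s *\<^sub>R b)) has_vector_derivative d t) (at t)"
    "norm (d t) \<le> k (\<xi> + t *\<^sub>R b) * norm (partial_deriv b f (\<xi> + t *\<^sub>R b))" for t
    using deriv by metis
  obtain T where T: "T < 0" "f (\<xi> + T *\<^sub>R b) = 0"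
    using exists_zero_on_line[OF supp, of b 0 \<xi>] b by (auto simp: nonzero_Basis)
  have line: "continuous_on UNIV (\<lambda>t::real. \<xi> + t *\<^sub>R b)"
    by (intro continuous_intros)
  show ?thesis
    using norm_le_nn_integral_derivative[OF d _ T(1) zero[OF T(2)]]
      continuous_on_compose2[OF cont(1) line] continuous_on_compose2[OF cont(2) line]
    by (simp add: continuous_on_mult continuous_on_norm)
qed

section \<open>Test functions and the Grushin gradient\<close>

lemma norm_partial_deriv_le_grushin_grad:
  fixes f :: "(real ^ 'n) \<times> (real ^ 'm) \<Rightarrow> 'b::real_normed_vector"
  shows "e \<in> Basis \<Longrightarrow> norm (partial_deriv (e, 0) f \<xi>) \<le> norm (grushin_grad \<beta> f \<xi>)"
    and "e' \<in> Basis \<Longrightarrow> norm (fst \<xi>) powr \<beta> * norm (partial_deriv (0, e') f \<xi>) \<le> norm (grushin_grad \<beta> f \<xi>)"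
proof -
  assume "e \<in> Basis"
  then obtain i where "e = axis i 1"
    by (auto simp: Basis_vec_def)
  then show "norm (partial_deriv (e, 0) f \<xi>) \<le> norm (grushin_grad \<beta> f \<xi>)"
    using Finite_Cartesian_Product.norm_nth_le[of "fst (grushin_grad \<beta> f \<xi>)" i]
      norm_fst_le[of "fst (grushin_grad \<beta> f \<xi>)" "snd (grushin_grad \<beta> f \<xi>)"]
    by (simp add: grushin_grad_def)
next
  assume "e' \<in> Basis"
  then obtain j where "e' = axis j 1"
    by (auto simp: Basis_vec_def)
  then show "norm (fst \<xi>) powr \<beta> * norm (partial_deriv (0, e') f \<xi>) \<le> norm (grushin_grad \<beta> f \<xi>)"
    using Finite_Cartesian_Product.norm_nth_le[of "snd (grushin_grad \<beta> f \<xi>)" j]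
      norm_snd_le[of "snd (grushin_grad \<beta> f \<xi>)" "fst (grushin_grad \<beta> f \<xi>)"]
    by (simp add: grushin_grad_def)
qed

lemma continuous_on_grushin_grad:
  fixes f :: "(real ^ 'n) \<times> (real ^ 'm) \<Rightarrow> 'b::real_normed_vector"
  assumes "0 < \<beta>" and cont: "\<And>b. b \<in> Basis \<Longrightarrow> continuous_on UNIV (partial_deriv b f)"
  shows "continuous_on UNIV (grushin_grad \<beta> f)"
proof -
  have [continuous_intros]: "continuous_on UNIV (partial_deriv (axis i 1, 0) f)"
    "continuous_on UNIV (partial_deriv (0, axis j 1) f)" for i j
    by (intro cont; simp add: Basis_prod_def)+
  show ?thesis
    unfolding grushin_grad_def[abs_def] using \<open>0 < \<beta>\<close>
    by (intro continuous_on_Pair continuous_on_vec_lambda continuous_on_scaleR continuous_on_powr'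
        continuous_intros) auto
qed

lemma grushin_grad_eq_0_outside_support:
  fixes f :: "(real ^ 'n) \<times> (real ^ 'm) \<Rightarrow> 'b::real_normed_vector"
  assumes "\<xi> \<notin> closure {\<xi>. f \<xi> \<noteq> 0}"
  shows "grushin_grad \<beta> f \<xi> = 0"
  using assms by (simp add: grushin_grad_def partial_deriv_eq_0_outside_support zero_prod_def vec_eq_iff)

lemma C_c_infinity_imp_C1:
  assumes "f \<in> C_c_infinity"
  shows "f differentiable (at \<xi>)" "b \<in> Basis \<Longrightarrow> continuous_on UNIV (partial_deriv b f)"
    "compact (closure {\<xi>. f \<xi> \<noteq> 0})"
proof -
  have "C_k 1 f"
    using assms by (simp add: C_c_infinity_def)
  then show "f differentiable (at \<xi>)" "b \<in> Basis \<Longrightarrow> continuous_on UNIV (partial_deriv b f)"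
    by auto
  show "compact (closure {\<xi>. f \<xi> \<noteq> 0})"
    using assms by (simp add: C_c_infinity_def)
qed

text \<open>Along a vertical line \<open>fst \<xi>\<close> is fixed, so the factor \<open>norm (fst \<xi>) powr \<beta>\<close> of the vertical part of the
Grushin gradient may be moved through the integral over that line.\<close>

lemma Grushin_Sobolev_chain:
  fixes f :: "(real ^ 'n::finite) \<times> (real ^ 'm::finite) \<Rightarrow> 'b::real_normed_vector"
    and h :: "(real ^ 'n) \<times> (real ^ 'm) \<Rightarrow> 'c::real_normed_vector"
    and k :: "(real ^ 'n) \<times> (real ^ 'm) \<Rightarrow> real"
    and \<beta> Q :: real
  assumes n: "2 \<le> CARD('n)" and \<beta>: "0 < \<beta>"
    and Q: "Q = real CARD('n) + real CARD('m) * (\<beta> + 1)"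
    and f: "f \<in> C_c_infinity"
    and h: "continuous_on UNIV h" "\<And>\<xi>. f \<xi> = 0 \<Longrightarrow> h \<xi> = 0"
    and k: "continuous_on UNIV k" "\<And>\<xi>. 0 \<le> k \<xi>"
    and deriv: "\<And>b \<xi> t. b \<in> Basis \<Longrightarrow> \<exists>d. ((\<lambda>s. h (\<xi> + s *\<^sub>R b)) has_vector_derivative d) (at t)
      \<and> norm d \<le> k (\<xi> + t *\<^sub>R b) * norm (partial_deriv b f (\<xi> + t *\<^sub>R b))"
  shows "(\<integral>\<^sup>+\<xi>. ennreal (norm (h \<xi>) powr (Q / (Q - 1))) \<partial>lborel)
    \<le> ennreal ((real CARD('n) * pi) powr (real CARD('m) * \<beta> / (Q - 1)))
      * epowr (\<integral>\<^sup>+\<xi>. ennreal (k \<xi> * norm (grushin_grad \<beta> f \<xi>)) \<partial>lborel) (Q / (Q - 1))"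
proof -
  note C1 = C_c_infinity_imp_C1[OF f]
  have line: "ennreal (norm (h \<xi>))
      \<le> (\<integral>\<^sup>+t. ennreal (k (\<xi> + t *\<^sub>R b) * norm (partial_deriv b f (\<xi> + t *\<^sub>R b))) \<partial>lborel)"
    if b: "b \<in> Basis" for b \<xi>
    by (rule norm_le_line_integral[OF C1(3) b C1(2)[OF b] k(1) h(2) deriv[OF b]])
  have "(\<integral>\<^sup>+\<xi>. ennreal (norm (h \<xi>) powr (Q / (Q - 1))) \<partial>lborel)
    \<le> ennreal ((DIM(real ^ 'n) * pi) powr (DIM(real ^ 'm) * \<beta> / (Q - 1)))
      * epowr (\<integral>\<^sup>+\<xi>. ennreal (k \<xi> * norm (grushin_grad \<beta> f \<xi>)) \<partial>lborel) (Q / (Q - 1))"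
  proof (rule Grushin_Sobolev_L1)
    show "(\<lambda>\<xi>. norm (h \<xi>)) \<in> borel_measurable borel"
      by (intro borel_measurable_continuous_onI continuous_on_norm h)
    show "(\<lambda>\<xi>. ennreal (k \<xi> * norm (grushin_grad \<beta> f \<xi>))) \<in> borel_measurable borel"
      by (intro measurable_compose[OF _ measurable_ennreal] borel_measurable_continuous_onI continuous_on_mult
          continuous_on_norm k continuous_on_grushin_grad \<beta> C1)
    fix \<xi> :: "(real ^ 'n) \<times> (real ^ 'm)"
    show "ennreal (norm (h \<xi>)) \<le> (\<integral>\<^sup>+t. ennreal (k (\<xi> + t *\<^sub>R (e, 0)) * norm (grushin_grad \<beta> f (\<xi> + t *\<^sub>R (e, 0)))) \<partial>lborel)"
      if e: "e \<in> Basis" for e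
    proof -
      have "(e, 0) \<in> (Basis :: ((real ^ 'n) \<times> (real ^ 'm)) set)"
        using e by (simp add: Basis_prod_def)
      from line[OF this, of \<xi>] show ?thesis
        by (rule order_trans)
          (intro nn_integral_mono ennreal_leI mult_left_mono norm_partial_deriv_le_grushin_grad e k(2))
    qed
    show "ennreal (norm (fst \<xi>) powr \<beta> * norm (h \<xi>))
        \<le> (\<integral>\<^sup>+t. ennreal (k (\<xi> + t *\<^sub>R (0, e)) * norm (grushin_grad \<beta> f (\<xi> + t *\<^sub>R (0, e)))) \<partial>lborel)"
      if e: "e \<in> Basis" for e
    proof -
      have b: "(0, e) \<in> (Basis :: ((real ^ 'n) \<times> (real ^ 'm)) set)"
        using e by (simp add: Basis_prod_def)
      let ?g = "\<lambda>t. k (\<xi> + t *\<^sub>R (0, e)) * norm (partial_deriv (0, e) f (\<xi> + t *\<^sub>R (0, e)))"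
      have "continuous_on UNIV ?g"
        by (intro continuous_on_mult continuous_on_norm continuous_on_compose2[OF k(1)]
            continuous_on_compose2[OF C1(2)[OF b]] continuous_intros) auto
      then have [measurable]: "?g \<in> borel_measurable borel"
        by (rule borel_measurable_continuous_onI)
      have "ennreal (norm (fst \<xi>) powr \<beta> * norm (h \<xi>))
          \<le> ennreal (norm (fst \<xi>) powr \<beta>) * (\<integral>\<^sup>+t. ennreal (?g t) \<partial>lborel)"
        using line[OF b, of \<xi>] by (simp add: ennreal_mult mult_left_mono)
      also have "\<dots> = (\<integral>\<^sup>+t. ennreal (norm (fst \<xi>) powr \<beta>) * ennreal (?g t) \<partial>lborel)"
        by (rule nn_integral_cmult[symmetric]) measurable
      also have "\<dots> \<le> (\<integral>\<^sup>+t. ennreal (k (\<xi> + t *\<^sub>R (0, e)) * norm (grushin_grad \<beta> f (\<xi> + t *\<^sub>R (0, e)))) \<partial>lborel)"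
      proof (rule nn_integral_mono)
        fix t :: real
        have "norm (fst \<xi>) powr \<beta> * norm (partial_deriv (0, e) f (\<xi> + t *\<^sub>R (0, e)))
            \<le> norm (grushin_grad \<beta> f (\<xi> + t *\<^sub>R (0, e)))"
          using norm_partial_deriv_le_grushin_grad(2)[OF e, of "\<xi> + t *\<^sub>R (0, e)" \<beta> f] by simp
        then have "norm (fst \<xi>) powr \<beta> * ?g t
            \<le> k (\<xi> + t *\<^sub>R (0, e)) * norm (grushin_grad \<beta> f (\<xi> + t *\<^sub>R (0, e)))"
          by (subst mult.left_commute) (rule mult_left_mono[OF _ k(2)])
        then show "ennreal (norm (fst \<xi>) powr \<beta>) * ennreal (?g t)
            \<le> ennreal (k (\<xi> + t *\<^sub>R (0, e)) * norm (grushin_grad \<beta> f (\<xi> + t *\<^sub>R (0, e))))"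
          using k(2) by (simp add: ennreal_leI flip: ennreal_mult)
      qed
      finally show ?thesis .
    qed
  qed (use n \<beta> Q in auto)
  then show ?thesis
    by simp
qed

section \<open>General exponents\<close>

text \<open>On the right-hand side \<open>B\<close> occurs with the exponent \<open>(p - 1) / p * (Q / (Q - 1))\<close>, which is smaller
than 1 because \<open>p < Q\<close>. After raising both sides to the power \<open>p * (Q - 1) / Q\<close>, the factor
\<open>B powr (p - 1)\<close> can be divided out.\<close>

lemma absorb_powr_bound:
  fixes B D K \<gamma> p Q :: real
  assumes B: "0 < B" and nonneg: "0 \<le> D" "0 \<le> K" "0 \<le> \<gamma>" and p: "1 \<le> p" "p < Q"
    and le: "B \<le> K * (\<gamma> * (B powr ((p - 1) / p) * D powr (1 / p))) powr (Q / (Q - 1))"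
  shows "B powr ((Q - p) / Q) \<le> K powr (p * (Q - 1) / Q) * \<gamma> powr p * D"
proof -
  let ?s = "p * (Q - 1) / Q"
  have s: "0 \<le> ?s" "Q / (Q - 1) * ?s = p"
    using p by simp_all
  have "B powr ?s \<le> (K * (\<gamma> * (B powr ((p - 1) / p) * D powr (1 / p))) powr (Q / (Q - 1))) powr ?s"
    using B s(1) le by (intro powr_mono2) auto
  also have "\<dots> = K powr ?s * (\<gamma> * (B powr ((p - 1) / p) * D powr (1 / p))) powr p"
    by (simp only: powr_mult[of K] powr_powr s(2))
  also have "\<dots> = K powr ?s * \<gamma> powr p * D * B powr (p - 1)"
    using nonneg B p by (simp add: powr_mult powr_powr)
  finally have "B powr ?s * B powr (1 - p) \<le> K powr ?s * \<gamma> powr p * D * B powr (p - 1) * B powr (1 - p)"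
    by (intro mult_right_mono) auto
  also have "\<dots> = K powr ?s * \<gamma> powr p * D"
    using B by (simp add: mult.assoc flip: powr_add)
  also have "B powr ?s * B powr (1 - p) = B powr ((Q - p) / Q)"
    using p by (simp add: field_simps flip: powr_add)
  finally show ?thesis .
qed


lemma C_c_infinity_integrable:
  fixes f :: "(real ^ 'n) \<times> (real ^ 'm) \<Rightarrow> 'b::real_normed_vector"
  assumes f: "f \<in> C_c_infinity" and "0 < \<beta>" "0 < r"
  shows "integrable lborel (\<lambda>\<xi>. norm (f \<xi>) powr r)"
    and "integrable lborel (\<lambda>\<xi>. norm (grushin_grad \<beta> f \<xi>) powr r)"
proof -
  note C1 = C_c_infinity_imp_C1[OF f]
  have "continuous_on UNIV f"
    using C1(1) by (intro continuous_at_imp_continuous_on ballI differentiable_imp_continuous_within)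
  then show "integrable lborel (\<lambda>\<xi>. norm (f \<xi>) powr r)"
    using C1(3) \<open>0 < r\<close> closure_subset[of "{\<xi>. f \<xi> \<noteq> 0}"]
    by (intro integrable_continuous_compact_support[where S = "closure {\<xi>. f \<xi> \<noteq> 0}"] continuous_on_powr'
        continuous_on_norm continuous_on_const) auto
  show "integrable lborel (\<lambda>\<xi>. norm (grushin_grad \<beta> f \<xi>) powr r)"
    using C1(3) \<open>0 < r\<close> \<open>0 < \<beta>\<close>
    by (intro integrable_continuous_compact_support[where S = "closure {\<xi>. f \<xi> \<noteq> 0}"] continuous_on_powr'
        continuous_on_norm continuous_on_const continuous_on_grushin_grad C1)
      (auto simp: grushin_grad_eq_0_outside_support)
qed

theorem theorem1p4:
  fixes \<beta> p Q :: real
  assumes "CARD('n::finite) \<ge> 2"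
    and "\<beta> > 0"
    and "Q = real CARD('n) + real CARD('m::finite) * (\<beta> + 1)"
    and "1 \<le> p" and "p < Q"
  shows "\<exists>C::real. \<forall>f \<in> (C_c_infinity :: ((real ^ 'n) \<times> (real ^ 'm) \<Rightarrow> complex) set).
    (LINT \<xi>|lborel. norm (f \<xi>) powr (Q * p / (Q - p))) powr ((Q - p) / Q)
      \<le> C * (LINT \<xi>|lborel. norm (grushin_grad \<beta> f \<xi>) powr p)"
proof -
  define K where "K = (real CARD('n) * pi) powr (real CARD('m) * \<beta> / (Q - 1))"
  \<comment> \<open>The power \<open>\<gamma>\<close> is chosen so that the critical exponent \<open>r\<close> arises twice: \<open>\<gamma> * (Q / (Q - 1)) = r\<close> on the
      left, and \<open>(\<gamma> - 1) * p = (p - 1) * r\<close> when Hoelder splits the gradient integral.\<close>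
  define \<gamma> where "\<gamma> = p * (Q - 1) / (Q - p)"
  define r where "r = Q * p / (Q - p)"
  have "\<gamma> - 1 = Q * (p - 1) / (Q - p)"
    unfolding \<gamma>_def using assms(5) by (simp add: field_simps)
  then have r3: "(\<gamma> - 1) * p = (p - 1) * r"
    by (simp add: r_def)
  have r: "0 < r" "\<gamma> * (Q / (Q - 1)) = r"
    using assms(4,5) by (auto simp: r_def \<gamma>_def mult_ac)
  have \<gamma>: "0 \<le> \<gamma>" "1 < p \<Longrightarrow> 1 < \<gamma>" "p = 1 \<Longrightarrow> \<gamma> = 1"
    using assms(4,5) by (auto simp: \<gamma>_def field_simps)
  have "(LINT \<xi>|lborel. norm (f \<xi>) powr r) powr ((Q - p) / Q)
      \<le> K powr (p * (Q - 1) / Q) * \<gamma> powr p * (LINT \<xi>|lborel. norm (grushin_grad \<beta> f \<xi>) powr p)"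
    if f: "f \<in> C_c_infinity" for f :: "(real ^ 'n) \<times> (real ^ 'm) \<Rightarrow> complex"
  proof -
    note C1 = C_c_infinity_imp_C1[OF f]
    have contf: "continuous_on UNIV f"
      using C1(1) by (intro continuous_at_imp_continuous_on ballI differentiable_imp_continuous_within)
    have line: "((\<lambda>s. f (\<xi> + s *\<^sub>R b)) has_vector_derivative partial_deriv b f (\<xi> + t *\<^sub>R b)) (at t)" for \<xi> b t
      by (intro has_vector_derivative_along_line C1)
    define B where "B = (LINT \<xi>|lborel. norm (f \<xi>) powr r)"
    define D where "D = (LINT \<xi>|lborel. norm (grushin_grad \<beta> f \<xi>) powr p)"
    have int: "integrable lborel (\<lambda>\<xi>. norm (f \<xi>) powr r)"
      "integrable lborel (\<lambda>\<xi>. norm (grushin_grad \<beta> f \<xi>) powr p)"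
      using C_c_infinity_integrable[OF f] assms(2,4) r(1) by auto
    have B: "(\<integral>\<^sup>+\<xi>. ennreal (norm (f \<xi>) powr r) \<partial>lborel) = ennreal B" "0 \<le> B"
      unfolding B_def using int(1) by (simp_all add: nn_integral_eq_integral)
    have D: "(\<integral>\<^sup>+\<xi>. ennreal (norm (grushin_grad \<beta> f \<xi>) powr p) \<partial>lborel) = ennreal D" "0 \<le> D"
      unfolding D_def using int(2) by (simp_all add: nn_integral_eq_integral)
    define R where "R = B powr ((p - 1) / p) * D powr (1 / p)"
    \<comment> \<open>For \<open>p = 1\<close> the factor \<open>B powr 0\<close> in \<open>R\<close> is 1 only if \<open>B \<noteq> 0\<close>.\<close>
    have "ennreal B \<le> ennreal (K * (\<gamma> * R) powr (Q / (Q - 1)))" if "0 < B"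
    proof (cases "p = 1")
      case True
      have "(\<integral>\<^sup>+\<xi>. ennreal (norm (f \<xi>) powr (Q / (Q - 1))) \<partial>lborel)
          \<le> ennreal K * epowr (\<integral>\<^sup>+\<xi>. ennreal (1 * norm (grushin_grad \<beta> f \<xi>)) \<partial>lborel) (Q / (Q - 1))"
        unfolding K_def
      proof (rule Grushin_Sobolev_chain[OF assms(1-3) f contf])
        fix b \<xi> t
        show "\<exists>d. ((\<lambda>s. f (\<xi> + s *\<^sub>R b)) has_vector_derivative d) (at t)
          \<and> norm d \<le> 1 * norm (partial_deriv b f (\<xi> + t *\<^sub>R b))"
          using line[where b = b and \<xi> = \<xi> and t = t] by fastforce
      qed auto
      moreover have "Q / (Q - 1) = r"
        using True by (simp add: r_def)
      moreover have "R = D"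
        using True that D(2) by (simp add: R_def)
      ultimately show ?thesis
        using True B(1) D \<gamma>(3) by (simp add: epowr_ennreal K_def flip: ennreal_mult)
    next
      case False
      then have p: "1 < p"
        using assms(4) by simp
      note \<gamma>1 = \<gamma>(2)[OF p]
      let ?k = "\<lambda>\<xi>. \<gamma> * norm (f \<xi>) powr (\<gamma> - 1)"
      have contk: "continuous_on UNIV ?k" and conth: "continuous_on UNIV (\<lambda>\<xi>. norm (f \<xi>) powr \<gamma>)"
        using \<gamma>1 by (intro continuous_on_mult continuous_on_powr' continuous_on_norm contf continuous_on_const; simp)+
      have contG: "continuous_on UNIV (grushin_grad \<beta> f)"
        by (intro continuous_on_grushin_grad assms C1)
      have [measurable]: "f \<in> borel_measurable borel" "(\<lambda>\<xi>. norm (grushin_grad \<beta> f \<xi>)) \<in> borel_measurable borel"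
        by (intro borel_measurable_continuous_onI continuous_on_norm contf contG)+
      have h_powr: "norm (norm (f \<xi>) powr \<gamma>) powr (Q / (Q - 1)) = norm (f \<xi>) powr r" for \<xi>
        using r(2) by (simp add: powr_powr)
      have "(\<integral>\<^sup>+\<xi>. ennreal (norm (norm (f \<xi>) powr \<gamma>) powr (Q / (Q - 1))) \<partial>lborel)
          \<le> ennreal K * epowr (\<integral>\<^sup>+\<xi>. ennreal (?k \<xi> * norm (grushin_grad \<beta> f \<xi>)) \<partial>lborel) (Q / (Q - 1))"
        unfolding K_def
      proof (rule Grushin_Sobolev_chain[OF assms(1-3) f conth _ contk])
        fix b \<xi> t
        show "\<exists>d. ((\<lambda>s. norm (f (\<xi> + s *\<^sub>R b)) powr \<gamma>) has_vector_derivative d) (at t)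
          \<and> norm d \<le> ?k (\<xi> + t *\<^sub>R b) * norm (partial_deriv b f (\<xi> + t *\<^sub>R b))"
          using norm_powr_has_real_derivative[OF line \<gamma>1, of \<xi> b t]
          by (auto simp: has_real_derivative_iff_has_vector_derivative)
      qed (use \<gamma>(1) in auto)
      also have "(\<integral>\<^sup>+\<xi>. ennreal (?k \<xi> * norm (grushin_grad \<beta> f \<xi>)) \<partial>lborel) \<le> ennreal (\<gamma> * R)"
      proof -
        have pw: "ennreal (?k \<xi> * norm (grushin_grad \<beta> f \<xi>)) = ennreal \<gamma> *
            (epowr (ennreal (norm (f \<xi>) powr r)) ((p - 1) / p) *
             epowr (ennreal (norm (grushin_grad \<beta> f \<xi>) powr p)) (1 / p))" for \<xi>
        proof -
          have "r * ((p - 1) / p) = \<gamma> - 1"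
            using r3 p by (simp add: field_simps)
          then show ?thesis
            using p \<gamma>(1) by (simp add: epowr_ennreal powr_powr mult.assoc flip: ennreal_mult)
        qed
        have "(\<integral>\<^sup>+\<xi>. ennreal (?k \<xi> * norm (grushin_grad \<beta> f \<xi>)) \<partial>lborel) = ennreal \<gamma> *
            (\<integral>\<^sup>+\<xi>. epowr (ennreal (norm (f \<xi>) powr r)) ((p - 1) / p) *
             epowr (ennreal (norm (grushin_grad \<beta> f \<xi>) powr p)) (1 / p) \<partial>lborel)"
          unfolding pw by (rule nn_integral_cmult) measurable
        also have "\<dots> \<le> ennreal \<gamma> * (epowr (ennreal B) ((p - 1) / p) * epowr (ennreal D) (1 / p))"
          unfolding B(1)[symmetric] D(1)[symmetric] using p
          by (intro mult_left_mono nn_integral_Holder_pair) (auto simp: field_simps)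
        also have "\<dots> = ennreal (\<gamma> * R)"
          using B D \<gamma>(1) by (simp add: R_def epowr_ennreal ennreal_mult)
        finally show ?thesis .
      qed
      finally have "ennreal B \<le> ennreal K * epowr (ennreal (\<gamma> * R)) (Q / (Q - 1))"
        using assms(4,5) by (simp only: h_powr B(1)) (simp add: epowr_mono mult_left_mono)
      then show ?thesis
        using \<gamma>(1) by (simp add: R_def K_def epowr_ennreal flip: ennreal_mult)
    qed
    then have "B powr ((Q - p) / Q) \<le> K powr (p * (Q - 1) / Q) * \<gamma> powr p * D" if "0 < B"
      using that D(2) \<gamma>(1) assms(4,5) unfolding R_def
      by (intro absorb_powr_bound) (auto simp: K_def)
    then show ?thesis
      using B(2) D(2) unfolding B_def[symmetric] D_def[symmetric]
      by (cases "B = 0") auto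
  qed
  then show ?thesis
    unfolding r_def by blast
qed

end
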